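(* Let $n\ge 1$ and $m\geq 1$ be integers, let $a_0,a_1,\dots,a_{m-1}$ be complex numbers, and let $P(\Delta)=\Delta^{m}+a_{m-1}\Delta^{m-1}+\cdots+a_{1}\Delta+a_0$, where $\Delta=\sum_{j=1}^n\frac{\partial^2}{\partial x_j^2}$ is the Laplace operator on $\mathbb{R}^n$. For each $f\in L^2(\mathbb{R}^n,e^{-|x|^2})$ there exists a weak solution $u\in L^2(\mathbb{R}^n,e^{-|x|^2})$ of the equation $$P(\Delta)u=f$$ in $\mathbb{R}^n$ with the norm estimate $$\int_{\mathbb{R}^n} |u|^2e^{-|x|^2}\,dx\leq \frac{1}{(8n)^m}\int_{\mathbb{R}^n} |f|^2e^{-|x|^2}\,dx.$$
   Context: Functions are complex-valued. For a nonnegative function $\varphi$ on $\mathbb{R}^n$, $L^2(\mathbb{R}^n,e^{-\varphi})$ is the weighted Hilbert space of all $f\in L^2_{loc}(\mathbb{R}^n)$ with $\int_{\mathbb{R}^n}|f|^2e^{-\varphi}\,dx<+\infty$; here $\varphi(x)=|x|^2$. Let $C_0^\infty(\mathbb{R}^n)$ be the set of smooth complex-valued functions with compact support. For $u,f\in L^2_{loc}(\mathbb{R}^n)$, $\Delta u=f$ in the weak sense means $\int_{\mathbb{R}^n}u\,\Delta\phi\,dx=\int_{\mathbb{R}^n}f\phi\,dx$ for all $\phi\in C_0^\infty(\mathbb{R}^n)$; likewise, $u$ is a weak solution of $P(\Delta)u=f$ if $\int_{\mathbb{R}^n}u\,P(\Delta)\phi\,dx=\int_{\mathbb{R}^n}f\phi\,dx$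 for all $\phi\in C_0^\infty(\mathbb{R}^n)$. *)

theory Defs
  imports "HOL-Analysis.Analysis"
begin

definition partial_deriv :: "'n::finite \<Rightarrow> (real ^ 'n \<Rightarrow> complex) \<Rightarrow> real ^ 'n \<Rightarrow> complex" where
  "partial_deriv j f x = vector_derivative (\<lambda>t. f (x + t *\<^sub>R axis j 1)) (at 0)"

definition laplacian :: "(real ^ 'n::finite \<Rightarrow> complex) \<Rightarrow> real ^ 'n \<Rightarrow> complex" where
  "laplacian f x = (\<Sum>j\<in>UNIV. partial_deriv j (partial_deriv j f) x)"

text \<open>
  The monic polynomial with lower coefficients \<open>a 0, \<dots>, a (m - 1)\<close>, evaluated at the Laplace
  operator; the values \<open>a k\<close> for \<open>k \<ge> m\<close> are ignored.
\<close>

definition poly_laplacian ::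
    "nat \<Rightarrow> (nat \<Rightarrow> complex) \<Rightarrow> (real ^ 'n::finite \<Rightarrow> complex) \<Rightarrow> real ^ 'n \<Rightarrow> complex" where
  "poly_laplacian m a f x = (laplacian ^^ m) f x + (\<Sum>k<m. a k * (laplacian ^^ k) f x)"

text \<open>
  The class \<open>C\<^sup>k\<close>. At each stage total differentiability is required; given that the partial
  derivatives are continuous, this is equivalent to their mere existence.
\<close>

fun times_cont_diff :: "nat \<Rightarrow> (real ^ 'n::finite \<Rightarrow> complex) \<Rightarrow> bool" where
  "times_cont_diff 0 f \<longleftrightarrow> continuous_on UNIV f"
| "times_cont_diff (Suc k) f \<longleftrightarrow>
     f differentiable_on UNIV \<and> (\<forall>j. times_cont_diff k (partial_deriv j f))"

definition test_function :: "(real ^ 'n::finite \<Rightarrow> complex) \<Rightarrow> bool" where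
  "test_function \<phi> \<longleftrightarrow> (\<forall>k. times_cont_diff k \<phi>) \<and> compact (closure {x. \<phi> x \<noteq> 0})"

text \<open>
  The two spaces below consist of functions rather than of classes modulo almost-everywhere
  equality. Measurability is with respect to the Lebesgue \<open>\<sigma>\<close>-algebra, not just the Borel one.
\<close>

definition L2_loc :: "(real ^ 'n::finite \<Rightarrow> complex) set" where
  "L2_loc = {f. f \<in> borel_measurable lebesgue \<and>
     (\<forall>K. compact K \<longrightarrow> set_integrable lebesgue K (\<lambda>x. (cmod (f x))\<^sup>2))}"

definition L2_weighted :: "(real ^ 'n::finite \<Rightarrow> real) \<Rightarrow> (real ^ 'n \<Rightarrow> complex) set" where
  "L2_weighted \<phi> = {f \<in> L2_loc. integrable lebesgue (\<lambda>x. (cmod (f x))\<^sup>2 * exp (- \<phi> x))}"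

definition weak_solution ::
    "nat \<Rightarrow> (nat \<Rightarrow> complex) \<Rightarrow> (real ^ 'n::finite \<Rightarrow> complex) \<Rightarrow> (real ^ 'n \<Rightarrow> complex) \<Rightarrow> bool" where
  "weak_solution m a f u \<longleftrightarrow>
     (\<forall>\<phi>. test_function \<phi> \<longrightarrow>
        (\<integral>x. u x * poly_laplacian m a \<phi> x \<partial>lebesgue) = (\<integral>x. f x * \<phi> x \<partial>lebesgue))"

end

theory Submission
  imports Defs "HOL-Computational_Algebra.Fundamental_Theorem_Algebra"
begin

text \<open>
  Over the complex numbers \<open>P\<close> splits into linear factors, so it is enough to solve
  \<open>(\<Delta> + l) u = f\<close> with a loss of \<open>1 / (8 n)\<close> that does not depend on \<open>l\<close>; the general equation
  follows by solving \<open>m\<close> such equations in a row, the solution of one being the right-hand side of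
  the next (\<open>weak_solution_monic\<close>).

  One equation is solved by duality. A weak solution is an element representing the functional
  \<open>(\<Delta> + l) \<phi> \<mapsto> \<integral> f \<phi>\<close>, which is defined on the image of the test functions. Put
  \<open>W x = exp (\<bar>x\<bar>\<^sup>2)\<close>. Since \<open>\<bar>\<integral> f \<phi>\<bar>\<^sup>2 \<le> (\<integral> \<bar>f\<bar>\<^sup>2 / W) (\<integral> \<bar>\<phi>\<bar>\<^sup>2 W)\<close>, the functional is bounded with the
  right constant as soon as
  \[ 8 n \int |\phi|^2 W \le \int |\Delta \phi + l \phi|^2 W \]
  for all test functions (\<open>laplacian_lower_bound\<close>); the Riesz representation theorem then gives the
  solution together with its bound (\<open>solve_laplacian_shift\<close>).

  The inequality is a commutator computation. In the inner product with weight \<open>W\<close>, the adjoint of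
  \<open>D\<^sub>j = \<partial>/\<partial>x\<^sub>j\<close> is \<open>B\<^sub>j \<phi> = - (D\<^sub>j \<phi> + 2 x\<^sub>j \<phi>)\<close>, and \<open>B\<^sub>i D\<^sub>j - D\<^sub>j B\<^sub>i = 2 \<delta>\<^sub>i\<^sub>j\<close>, as for the creation and
  annihilation operators of the harmonic oscillator. Hence
  \<open>B\<^sub>i\<^sup>2 D\<^sub>j\<^sup>2 - D\<^sub>j\<^sup>2 B\<^sub>i\<^sup>2 = 8 \<delta>\<^sub>i\<^sub>j (D\<^sub>j B\<^sub>j + 1)\<close>, and, with \<open>L = \<Delta> + l\<close> and its adjoint \<open>L\<^sup>*\<close>,
  \[ \|L\phi\|^2 = \|L^*\phi\|^2 + 8 \sum_j \|B_j\phi\|^2 + 8 n \|\phi\|^2. \]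
  The number \<open>l\<close> commutes with everything and so leaves no trace in the last two terms.
\<close>

section \<open>Smooth functions and test functions\<close>

text \<open>
  Test functions are differentiable as functions of several variables, so their partial derivatives
  can be read off from the total derivative, and the product and chain rules carry over from there.
\<close>

lemma partial_deriv_eq:
  assumes "(f has_derivative f') (at x)"
  shows "partial_deriv j f x = f' (axis j 1)"
proof -
  have "((\<lambda>t. f (x + t *\<^sub>R axis j 1)) has_derivative (\<lambda>t. f' (t *\<^sub>R axis j 1))) (at 0)"
    by (rule has_derivative_compose[where f = "\<lambda>t. x + t *\<^sub>R axis j 1"])
      (auto intro!: derivative_eq_intros assms)
  moreover have "f' (t *\<^sub>R axis j 1) = t *\<^sub>R f' (axis j 1)" for t
    using assms has_derivative_linear linear_scale by blast
  ultimately have "((\<lambda>t. f (x + t *\<^sub>R axis j 1)) has_vector_derivative f' (axis j 1)) (at 0)"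
    by (simp add: has_vector_derivative_def)
  then show ?thesis
    unfolding partial_deriv_def by (rule vector_derivative_at)
qed

lemma has_vector_derivative_line:
  assumes "f differentiable (at (x + s *\<^sub>R axis j 1))"
  shows "((\<lambda>t. f (x + t *\<^sub>R axis j 1)) has_vector_derivative
           partial_deriv j f (x + s *\<^sub>R axis j 1)) (at s within S)"
proof -
  obtain f' where f': "(f has_derivative f') (at (x + s *\<^sub>R axis j 1))"
    using assms by (auto simp: differentiable_def)
  have "((\<lambda>t. f (x + t *\<^sub>R axis j 1)) has_derivative (\<lambda>t. f' (t *\<^sub>R axis j 1))) (at s within S)"
    by (rule has_derivative_compose[where f = "\<lambda>t. x + t *\<^sub>R axis j 1"])
      (auto intro!: derivative_eq_intros f')
  moreover have "f' (t *\<^sub>R axis j 1) = t *\<^sub>R f' (axis j 1)" for t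
    using f' has_derivative_linear linear_scale by blast
  ultimately show ?thesis
    using partial_deriv_eq[OF f', of j] by (simp add: has_vector_derivative_def)
qed

definition smooth :: "(real ^ 'n::finite \<Rightarrow> complex) \<Rightarrow> bool" where
  "smooth f \<longleftrightarrow> (\<forall>k. times_cont_diff k f)"

lemma smooth_differentiable: "smooth f \<Longrightarrow> f differentiable (at x)"
  unfolding smooth_def
  by (metis UNIV_I differentiable_on_def times_cont_diff.simps(2))

lemma smooth_has_derivative:
  "smooth f \<Longrightarrow> (f has_derivative frechet_derivative f (at x)) (at x)"
  using frechet_derivative_works smooth_differentiable by blast

lemma smooth_continuous: "smooth f \<Longrightarrow> continuous_on S f"
  unfolding smooth_def by (metis continuous_on_subset subset_UNIV times_cont_diff.simps(1))

lemma smooth_partial_deriv: "smooth f \<Longrightarrow> smooth (partial_deriv j f)"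
  unfolding smooth_def by (metis times_cont_diff.simps(2))

lemma partial_deriv_add:
  assumes "smooth f" "smooth g"
  shows "partial_deriv j (\<lambda>x. f x + g x) x = partial_deriv j f x + partial_deriv j g x"
  by (subst partial_deriv_eq[OF has_derivative_add[OF assms[THEN smooth_has_derivative]]])
    (simp add: assms smooth_has_derivative[THEN partial_deriv_eq])

lemma partial_deriv_cmult:
  assumes "smooth f"
  shows "partial_deriv j (\<lambda>x. c * f x) x = c * partial_deriv j f x"
  by (subst partial_deriv_eq[OF has_derivative_mult_right[OF assms[THEN smooth_has_derivative]]])
    (simp add: assms smooth_has_derivative[THEN partial_deriv_eq])

lemma partial_deriv_coord_mult:
  assumes "smooth f"
  shows "partial_deriv j (\<lambda>x. of_real (x $ i) * f x) x =
    (if i = j then f x else 0) + of_real (x $ i) * partial_deriv j f x"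
proof -
  have "((\<lambda>x. of_real (x $ i) * f x) has_derivative
     (\<lambda>h. of_real (x $ i) * frechet_derivative f (at x) h + of_real (h $ i) * f x)) (at x)"
    by (intro has_derivative_mult has_derivative_of_real smooth_has_derivative[OF assms])
      (auto intro!: bounded_linear_imp_has_derivative bounded_linear_vec_nth)
  from partial_deriv_eq[OF this, of j] show ?thesis
    by (simp add: axis_def smooth_has_derivative[OF assms, THEN partial_deriv_eq])
qed

text \<open>
  Smooth functions are the largest class of differentiable functions that is closed under partial
  derivatives. To see that a function is smooth one therefore exhibits such a class around it, which
  replaces an induction on the order of differentiability for each operation on functions.
\<close>

lemma smooth_coinduct:
  assumes "X f"
    and diff: "\<And>f x. X f \<Longrightarrow> f differentiable (at x)"
    and step: "\<And>f j. X f \<Longrightarrow> X (partial_deriv j f)"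
  shows "smooth f"
proof -
  have "X f \<Longrightarrow> times_cont_diff k f" for k f
  proof (induction k arbitrary: f)
    case 0
    then show ?case
      using diff by (simp add: continuous_on_eq_continuous_within differentiable_imp_continuous_within)
  next
    case (Suc k)
    then show ?case
      using diff step by (auto simp: differentiable_on_def)
  qed
  with assms(1) show ?thesis by (simp add: smooth_def)
qed

lemma smooth_add:
  assumes "smooth f" "smooth g"
  shows "smooth (\<lambda>x. f x + g x)"
proof (rule smooth_coinduct[where X = "\<lambda>h. \<exists>f g. smooth f \<and> smooth g \<and> h = (\<lambda>x. f x + g x)"])
  show "\<exists>f' g'. smooth f' \<and> smooth g' \<and> (\<lambda>x. f x + g x) = (\<lambda>x. f' x + g' x)"
    using assms by blast
next
  fix h :: "real^'a \<Rightarrow> complex" and x assume "\<exists>f g. smooth f \<and> smooth g \<and> h = (\<lambda>x. f x + g x)"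
  then obtain f g where "smooth f" "smooth g" "h = (\<lambda>x. f x + g x)" by blast
  then show "h differentiable (at x)"
    using differentiable_add[OF smooth_differentiable smooth_differentiable] by blast
next
  fix h :: "real^'a \<Rightarrow> complex" and j assume "\<exists>f g. smooth f \<and> smooth g \<and> h = (\<lambda>x. f x + g x)"
  then obtain f g where "smooth f" "smooth g" "h = (\<lambda>x. f x + g x)" by blast
  then show "\<exists>f g. smooth f \<and> smooth g \<and> partial_deriv j h = (\<lambda>x. f x + g x)"
    by (intro exI[of _ "partial_deriv j f"] exI[of _ "partial_deriv j g"])
      (auto simp: smooth_partial_deriv partial_deriv_add)
qed

lemma smooth_cmult:
  assumes "smooth f"
  shows "smooth (\<lambda>x. c * f x)"
proof (rule smooth_coinduct[where X = "\<lambda>h. \<exists>f. smooth f \<and> h = (\<lambda>x. c * f x)"])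
  show "\<exists>f'. smooth f' \<and> (\<lambda>x. c * f x) = (\<lambda>x. c * f' x)"
    using assms by blast
next
  fix h :: "real^'a \<Rightarrow> complex" and x assume "\<exists>f. smooth f \<and> h = (\<lambda>x. c * f x)"
  then obtain f where "smooth f" "h = (\<lambda>x. c * f x)" by blast
  then show "h differentiable (at x)"
    using differentiable_mult[OF differentiable_const smooth_differentiable] by blast
next
  fix h :: "real^'a \<Rightarrow> complex" and j assume "\<exists>f. smooth f \<and> h = (\<lambda>x. c * f x)"
  then obtain f where "smooth f" "h = (\<lambda>x. c * f x)" by blast
  then show "\<exists>f. smooth f \<and> partial_deriv j h = (\<lambda>x. c * f x)"
    by (intro exI[of _ "partial_deriv j f"]) (auto simp: smooth_partial_deriv partial_deriv_cmult)
qed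

lemma smooth_coord_mult:
  assumes "smooth f"
  shows "smooth (\<lambda>x. of_real (x $ i) * f x)"
\<comment> \<open>The derivative of \<open>x\<^sub>i f\<close> has the extra term \<open>\<delta>\<^sub>i\<^sub>j f\<close>, so the class has to allow a smooth summand.\<close>
proof (rule smooth_coinduct[where X = "\<lambda>h. \<exists>g f. smooth g \<and> smooth f \<and> h = (\<lambda>x. g x + of_real (x $ i) * f x)"])
  show "\<exists>g f'. smooth g \<and> smooth f' \<and> (\<lambda>x. of_real (x $ i) * f x) = (\<lambda>x. g x + of_real (x $ i) * f' x)"
    using smooth_cmult[OF assms, of 0] assms by (intro exI[of _ "\<lambda>x. 0"] exI[of _ f]) auto
next
  fix h :: "real^'a \<Rightarrow> complex" and x
  assume "\<exists>g f. smooth g \<and> smooth f \<and> h = (\<lambda>x. g x + of_real (x $ i) * f x)"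
  then obtain g f where g: "smooth g" and f: "smooth f"
    and h: "h = (\<lambda>x. g x + of_real (x $ i) * f x)" by blast
  have "(\<lambda>x. complex_of_real (x $ i)) differentiable (at x)"
    by (intro bounded_linear_imp_differentiable
        bounded_linear_compose[OF bounded_linear_of_real bounded_linear_vec_nth])
  then show "h differentiable (at x)"
    unfolding h
    by (rule differentiable_add[OF smooth_differentiable[OF g]
          differentiable_mult[OF _ smooth_differentiable[OF f]]])
next
  fix h :: "real^'a \<Rightarrow> complex" and j
  assume "\<exists>g f. smooth g \<and> smooth f \<and> h = (\<lambda>x. g x + of_real (x $ i) * f x)"
  then obtain g f where g: "smooth g" and f: "smooth f"
    and h: "h = (\<lambda>x. g x + of_real (x $ i) * f x)" by blast
  have "(h has_derivative (\<lambda>v. frechet_derivative g (at x) v +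
      (of_real (x $ i) * frechet_derivative f (at x) v + of_real (v $ i) * f x))) (at x)" for x
    unfolding h
    by (intro has_derivative_add has_derivative_mult has_derivative_of_real smooth_has_derivative f g)
      (auto intro!: bounded_linear_imp_has_derivative bounded_linear_vec_nth)
  from partial_deriv_eq[OF this, of j]
  have "partial_deriv j h = (\<lambda>x. (partial_deriv j g x + (if i = j then 1 else 0) * f x)
      + of_real (x $ i) * partial_deriv j f x)"
    by (auto simp: axis_def f g smooth_has_derivative[THEN partial_deriv_eq] fun_eq_iff)
  then show "\<exists>g f. smooth g \<and> smooth f \<and> partial_deriv j h = (\<lambda>x. g x + of_real (x $ i) * f x)"
    using smooth_add[OF smooth_partial_deriv[OF g] smooth_cmult[OF f]] smooth_partial_deriv[OF f]
    by blast
qed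

text \<open>
  Schwarz's theorem. By the fundamental theorem of calculus,
  \<open>f (x + s e\<^sub>i + t e\<^sub>j) - f (x + s e\<^sub>i)\<close> is the integral of \<open>\<partial>\<^sub>j f\<close> over \<open>[0, t]\<close>. Differentiating under the
  integral sign in \<open>s\<close>, and then in \<open>t\<close> at \<open>0\<close>, turns the left-hand side into \<open>\<partial>\<^sub>j \<partial>\<^sub>i f\<close> and the
  right-hand side into \<open>\<partial>\<^sub>i \<partial>\<^sub>j f\<close>. This argument works for complex values without splitting them
  into real and imaginary parts.
\<close>

lemma partial_deriv_commute:
  assumes "smooth f"
  shows "partial_deriv i (partial_deriv j f) x = partial_deriv j (partial_deriv i f) x"
proof -
  let ?p = "\<lambda>s t. x + s *\<^sub>R axis i 1 + t *\<^sub>R axis j 1"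
  let ?g = "\<lambda>s. f (x + s *\<^sub>R axis i 1)"
  let ?h = "\<lambda>t. integral {0..t} (\<lambda>r. partial_deriv i (partial_deriv j f) (x + r *\<^sub>R axis j 1))"
  have line: "((\<lambda>s. h (?p s t)) has_vector_derivative partial_deriv i h (?p s t)) (at s within S)"
    if "smooth h" for h s t S
  proof -
    have eq: "?p s t = (x + t *\<^sub>R axis j 1) + s *\<^sub>R axis i 1" for s t by simp
    show ?thesis
      unfolding eq by (rule has_vector_derivative_line[OF smooth_differentiable[OF that]])
  qed
  have ftc: "integral {0..t} (\<lambda>r. partial_deriv j f (?p s r)) = f (?p s t) - f (?p s 0)"
    if "0 \<le> t" for s t
    using that by (intro integral_unique fundamental_theorem_of_calculus)
      (auto intro!: has_vector_derivative_line smooth_differentiable assms)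
  have key: "partial_deriv i f (?p 0 t) - partial_deriv i f x = ?h t" if t: "0 \<le> t" for t
  proof -
    have "((\<lambda>s. integral (cbox 0 t) (\<lambda>r. partial_deriv j f (?p s r))) has_vector_derivative
        integral (cbox 0 t) (\<lambda>r. partial_deriv i (partial_deriv j f) (?p 0 r))) (at 0 within UNIV)"
    proof (rule leibniz_rule_vector_derivative[where fx = "\<lambda>s r. partial_deriv i (partial_deriv j f) (?p s r)"])
      fix s show "(\<lambda>r. partial_deriv j f (?p s r)) integrable_on cbox 0 t"
        by (intro integrable_continuous continuous_on_compose2[OF smooth_continuous[of "partial_deriv j f" UNIV]])
          (auto intro!: continuous_intros smooth_partial_deriv assms)
    next
      show "continuous_on (UNIV \<times> cbox 0 t) (\<lambda>(s, r). partial_deriv i (partial_deriv j f) (?p s r))"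
        unfolding split_beta
        by (intro continuous_on_compose2[OF smooth_continuous[of "partial_deriv i (partial_deriv j f)" UNIV]])
          (auto intro!: continuous_intros smooth_partial_deriv assms)
    qed (auto intro!: line smooth_partial_deriv assms)
    moreover have "((\<lambda>s. f (?p s t) - f (?p s 0)) has_vector_derivative
        partial_deriv i f (?p 0 t) - partial_deriv i f (?p 0 0)) (at 0 within UNIV)"
      by (intro has_vector_derivative_diff line assms)
    ultimately show ?thesis
      using t by (simp add: ftc vector_derivative_unique_at)
  qed
  have "(?h has_vector_derivative partial_deriv i (partial_deriv j f) (x + 0 *\<^sub>R axis j 1))
      (at 0 within {0..1})"
    by (intro integral_has_vector_derivative continuous_on_compose2[OF smooth_continuous[of "partial_deriv i (partial_deriv j f)" UNIV]])
          (auto intro!: continuous_intros smooth_partial_deriv assms)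
  then have "(?h has_derivative (\<lambda>s. s *\<^sub>R partial_deriv i (partial_deriv j f) x)) (at 0 within {0..1})"
    by (simp add: has_vector_derivative_def)
  then have "((\<lambda>t. partial_deriv i f (?p 0 t) - partial_deriv i f x) has_vector_derivative
      partial_deriv i (partial_deriv j f) x) (at 0 within {0..1})"
    unfolding has_vector_derivative_def
  proof (rule has_derivative_transform[rotated 2])
    fix t :: real assume "t \<in> {0..1}"
    then show "partial_deriv i f (?p 0 t) - partial_deriv i f x = ?h t"
      by (intro key) simp
  qed simp
  moreover have "((\<lambda>t. partial_deriv i f (?p 0 t) - partial_deriv i f x) has_vector_derivative
      partial_deriv j (partial_deriv i f) x - 0) (at 0 within {0..1})"
    using has_vector_derivative_line[OF smooth_differentiable[OF smooth_partial_deriv[OF assms]],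
        where s = 0 and x = x and j = j]
    by (intro has_vector_derivative_diff) auto
  ultimately show ?thesis
    using vector_derivative_unique_within_closed_interval[of 0 "1::real" 0] by fastforce
qed

text \<open>
  Vanishing outside a ball is easier to propagate than compactness of the closed support.
\<close>

lemma test_function_iff: "test_function f \<longleftrightarrow> smooth f \<and> (\<exists>R. \<forall>x. norm x \<ge> R \<longrightarrow> f x = 0)"
proof
  assume f: "test_function f"
  then have "bounded {x. f x \<noteq> 0}"
    using bounded_subset[OF compact_imp_bounded closure_subset] by (auto simp: test_function_def)
  then obtain R where "\<forall>x\<in>{x. f x \<noteq> 0}. norm x \<le> R" by (auto simp: bounded_iff)
  then have "\<forall>x. norm x \<ge> R + 1 \<longrightarrow> f x = 0" by force
  with f show "smooth f \<and> (\<exists>R. \<forall>x. norm x \<ge> R \<longrightarrow> f x = 0)"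
    by (auto simp: test_function_def smooth_def)
next
  assume "smooth f \<and> (\<exists>R. \<forall>x. norm x \<ge> R \<longrightarrow> f x = 0)"
  then obtain R where f: "smooth f" and "\<forall>x. norm x \<ge> R \<longrightarrow> f x = 0" by blast
  then have "{x. f x \<noteq> 0} \<subseteq> ball 0 R" by force
  then have "bounded {x. f x \<noteq> 0}" using bounded_subset bounded_ball by blast
  with f show "test_function f"
    by (auto simp: test_function_def smooth_def compact_closure)
qed

lemma test_function_smooth: "test_function f \<Longrightarrow> smooth f"
  by (simp add: test_function_iff)

lemma test_function_partial_deriv:
  assumes "test_function f"
  shows "test_function (partial_deriv j f)"
proof -
  obtain R where R: "\<And>x. norm x \<ge> R \<Longrightarrow> f x = 0" and f: "smooth f"
    using assms by (auto simp: test_function_iff)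
  have "partial_deriv j f x = 0" if "norm x \<ge> R + 1" for x
  proof -
    have "open {x::real^'a. norm x > R}" by (intro open_Collect_less continuous_intros)
    moreover have "x \<in> {x. norm x > R}" using that by simp
    ultimately have "(f has_derivative (\<lambda>_. 0)) (at x)"
      using R by (intro has_derivative_transform_within_open[OF has_derivative_const[of 0]]) auto
    from partial_deriv_eq[OF this] show ?thesis by simp
  qed
  then show ?thesis
    using f by (auto simp: test_function_iff smooth_partial_deriv)
qed

lemma test_function_add:
  assumes "test_function f" "test_function g"
  shows "test_function (\<lambda>x. f x + g x)"
proof -
  obtain R S where "\<And>x. norm x \<ge> R \<Longrightarrow> f x = 0" "\<And>x. norm x \<ge> S \<Longrightarrow> g x = 0"
    using assms by (auto simp: test_function_iff)
  then have "\<forall>x. norm x \<ge> max R S \<longrightarrow> f x + g x = 0" by simp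
  with assms show ?thesis unfolding test_function_iff by (blast intro: smooth_add)
qed

lemma test_function_cmult: "test_function f \<Longrightarrow> test_function (\<lambda>x. c * f x)"
  by (force simp: test_function_iff smooth_cmult)

lemma test_function_coord_mult: "test_function f \<Longrightarrow> test_function (\<lambda>x. of_real (x $ i) * f x)"
  by (force simp: test_function_iff smooth_coord_mult)

lemma test_function_0: "test_function (\<lambda>x. 0)"
proof -
  have "smooth (\<lambda>x::real^'n. 0)"
    by (rule smooth_coinduct[where X = "\<lambda>f. f = (\<lambda>x. 0)"]) (auto simp: partial_deriv_def)
  then show ?thesis by (simp add: test_function_iff)
qed

lemma test_function_sum:
  assumes "\<And>i. i \<in> I \<Longrightarrow> test_function (f i)"
  shows "test_function (\<lambda>x. \<Sum>i\<in>I. f i x)"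
  using assms by (induction I rule: infinite_finite_induct) (auto intro: test_function_0 test_function_add)

lemma test_function_laplacian:
  assumes "test_function f"
  shows "test_function (laplacian f)"
proof -
  have "laplacian f = (\<lambda>x. \<Sum>j\<in>UNIV. partial_deriv j (partial_deriv j f) x)"
    by (auto simp: laplacian_def)
  with assms show ?thesis
    by (simp add: test_function_sum test_function_partial_deriv)
qed

section \<open>Square integrable functions and the Riesz representation theorem\<close>

definition square_integrable :: "'a measure \<Rightarrow> ('a \<Rightarrow> complex) \<Rightarrow> bool" where
  "square_integrable M f \<longleftrightarrow> f \<in> borel_measurable M \<and> integrable M (\<lambda>x. (cmod (f x))\<^sup>2)"

definition sq_norm :: "'a measure \<Rightarrow> ('a \<Rightarrow> complex) \<Rightarrow> real" where
  "sq_norm M f = (\<integral>x. (cmod (f x))\<^sup>2 \<partial>M)"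

lemma sq_norm_nonneg: "0 \<le> sq_norm M f"
  by (simp add: sq_norm_def)

lemma square_integrable_mult:
  assumes "square_integrable M f" "square_integrable M g"
  shows "integrable M (\<lambda>x. f x * g x)"
proof (rule Bochner_Integration.integrable_bound)
  show "integrable M (\<lambda>x. (cmod (f x))\<^sup>2 + (cmod (g x))\<^sup>2)"
    using assms by (simp add: square_integrable_def)
  have "cmod (f x * g x) \<le> (cmod (f x))\<^sup>2 + (cmod (g x))\<^sup>2" for x
    using sum_squares_bound[of "cmod (f x)" "cmod (g x)"]
      mult_nonneg_nonneg[OF norm_ge_zero[of "f x"] norm_ge_zero[of "g x"]]
    unfolding norm_mult by linarith
  then show "AE x in M. cmod (f x * g x) \<le> norm ((cmod (f x))\<^sup>2 + (cmod (g x))\<^sup>2)"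
    by simp
qed (use assms in \<open>auto simp: square_integrable_def\<close>)

lemma square_integrable_cnj: "square_integrable M f \<Longrightarrow> square_integrable M (\<lambda>x. cnj (f x))"
  unfolding square_integrable_def
  by (simp add: measurable_compose[OF _ borel_measurable_continuous_onI[OF continuous_on_cnj[OF continuous_on_id]]])

lemma square_integrable_cmult: "square_integrable M f \<Longrightarrow> square_integrable M (\<lambda>x. c * f x)"
  by (auto simp: square_integrable_def norm_mult power_mult_distrib)

lemma integral_mult_cnj_self: "(\<integral>x. f x * cnj (f x) \<partial>M) = of_real (sq_norm M f)"
proof -
  have "(\<integral>x. f x * cnj (f x) \<partial>M) = (\<integral>x. complex_of_real ((cmod (f x))\<^sup>2) \<partial>M)"
    by (simp add: complex_norm_square del: of_real_power)
  then show ?thesis by (simp add: sq_norm_def del: of_real_power)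
qed

lemma cmod_add_sq: "(cmod (a + b))\<^sup>2 = (cmod a)\<^sup>2 + (cmod b)\<^sup>2 + 2 * Re (a * cnj b)"
  unfolding cmod_power2 by (simp add: power2_eq_square algebra_simps)

lemma
  assumes "square_integrable M f" "square_integrable M g"
  shows square_integrable_add: "square_integrable M (\<lambda>x. f x + g x)"
    and sq_norm_add: "sq_norm M (\<lambda>x. f x + g x) =
       sq_norm M f + sq_norm M g + 2 * Re (\<integral>x. f x * cnj (g x) \<partial>M)"
proof -
  have i: "integrable M (\<lambda>x. f x * cnj (g x))"
    using assms by (intro square_integrable_mult square_integrable_cnj)
  have ri: "integrable M (\<lambda>x. Re (f x * cnj (g x)))"
    by (rule integrable_Re[OF i])
  have r: "Re (\<integral>x. f x * cnj (g x) \<partial>M) = (\<integral>x. Re (f x * cnj (g x)) \<partial>M)"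
    by (rule integral_Re[OF i, symmetric])
  show "square_integrable M (\<lambda>x. f x + g x)"
    using assms ri unfolding square_integrable_def cmod_add_sq by (auto simp del: times_complex.sel)
  show "sq_norm M (\<lambda>x. f x + g x) =
       sq_norm M f + sq_norm M g + 2 * Re (\<integral>x. f x * cnj (g x) \<partial>M)"
    using assms ri unfolding sq_norm_def square_integrable_def cmod_add_sq r
    by (simp del: times_complex.sel)
qed

lemma sq_norm_cmult: "sq_norm M (\<lambda>x. c * f x) = (cmod c)\<^sup>2 * sq_norm M f"
  by (simp add: sq_norm_def norm_mult power_mult_distrib)

lemma square_integrable_diff:
  "square_integrable M f \<Longrightarrow> square_integrable M g \<Longrightarrow> square_integrable M (\<lambda>x. f x - g x)"
  using square_integrable_add[of M f "\<lambda>x. (-1) * g x"] square_integrable_cmult[of M g "-1"] by simp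

lemma sq_norm_diff:
  assumes "square_integrable M f" "square_integrable M g"
  shows "sq_norm M (\<lambda>x. f x - g x) =
       sq_norm M f + sq_norm M g - 2 * Re (\<integral>x. f x * cnj (g x) \<partial>M)"
  using sq_norm_add[OF assms(1) square_integrable_cmult[OF assms(2), of "-1"]] sq_norm_cmult[of M "-1" g]
  by simp

lemma cauchy_schwarz_integral:
  assumes "square_integrable M f" "square_integrable M g"
  shows "(cmod (\<integral>x. f x * g x \<partial>M))\<^sup>2 \<le> sq_norm M f * sq_norm M g"
proof -
  define P where "P = (\<integral>x. f x * g x \<partial>M)"
  define F where "F = sq_norm M f"
  define G where "G = sq_norm M g"
  have "F \<ge> 0" "G \<ge> 0" by (simp_all add: F_def G_def sq_norm_nonneg)
  have key: "0 \<le> F + t\<^sup>2 * (cmod P)\<^sup>2 * G - 2 * t * (cmod P)\<^sup>2" for t :: real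
  proof -
    \<comment> \<open>The phase of \<open>P\<close> makes the cross term real, so a real parameter \<open>t\<close> is enough.\<close>
    let ?h = "\<lambda>x. (complex_of_real t * P) * cnj (g x)"
    have h: "square_integrable M ?h"
      by (intro square_integrable_cmult square_integrable_cnj assms)
    have "0 \<le> sq_norm M (\<lambda>x. f x - ?h x)" by (rule sq_norm_nonneg)
    also have "\<dots> = F + sq_norm M ?h - 2 * Re (\<integral>x. f x * cnj (?h x) \<partial>M)"
      unfolding F_def by (rule sq_norm_diff[OF assms(1) h])
    also have "sq_norm M ?h = t\<^sup>2 * (cmod P)\<^sup>2 * G"
      unfolding sq_norm_cmult by (simp add: norm_mult power_mult_distrib G_def sq_norm_def)
    also have "(\<integral>x. f x * cnj (?h x) \<partial>M) = (\<integral>x. (t * cnj P) * (f x * g x) \<partial>M)"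
      by (simp add: mult_ac)
    also have "\<dots> = (t * cnj P) * P"
      unfolding P_def by (rule integral_mult_right_zero)
    also have "Re \<dots> = t * (cmod P)\<^sup>2"
      unfolding cmod_power2 by (simp add: power2_eq_square algebra_simps)
    finally show ?thesis by (simp add: algebra_simps)
  qed
  have "(cmod P)\<^sup>2 \<le> F * G"
  proof (cases "G = 0")
    case True
    have "(cmod P)\<^sup>2 = 0"
    proof (rule ccontr)
      assume "(cmod P)\<^sup>2 \<noteq> 0"
      then show False
        using key[of "(F + 1) / (cmod P)\<^sup>2"] True \<open>F \<ge> 0\<close> by simp
    qed
    then show ?thesis using True by simp
  next
    case False
    then show ?thesis
      using key[of "1 / G"] \<open>G \<ge> 0\<close> by (simp add: field_simps power2_eq_square)
  qed
  then show ?thesis by (simp add: P_def F_def G_def)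
qed

text \<open>
  Completeness of \<open>L\<^sup>2\<close>, for sequences that converge geometrically fast, so that no subsequence has to be
  chosen. The sum of \<open>4\<^sup>k \<bar>v\<^sub>k - v\<^sub>k\<^sub>+\<^sub>1\<bar>\<^sup>2\<close> over \<open>k\<close> is integrable, hence finite almost everywhere; there
  \<open>\<bar>v\<^sub>k - v\<^sub>k\<^sub>+\<^sub>1\<bar>\<close> is \<open>O(2\<^sup>-\<^sup>k)\<close> and the sequence converges. Fatou's lemma carries the bounds over to the
  pointwise limit.
\<close>

lemma L2_complete:
  assumes v: "\<And>k. square_integrable M (v k)"
    and cauchy: "\<And>k l. k \<le> l \<Longrightarrow> sq_norm M (\<lambda>x. v k x - v l x) \<le> K * (1/16)^k"
  obtains g where "square_integrable M g"
    and "\<And>k. sq_norm M (\<lambda>x. v k x - g x) \<le> K * (1/16)^k"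
proof -
  have [measurable]: "v k \<in> borel_measurable M" for k
    using v by (simp add: square_integrable_def)
  have "K \<ge> 0"
    using cauchy[of 0 0] sq_norm_nonneg[of M "\<lambda>x. v 0 x - v 0 x"] by simp
  have nn: "(\<integral>\<^sup>+x. ennreal ((cmod (v k x - v l x))\<^sup>2) \<partial>M) = ennreal (sq_norm M (\<lambda>x. v k x - v l x))" for k l
    unfolding sq_norm_def
    using square_integrable_diff[OF v v, of k l]
    by (intro nn_integral_eq_integral) (auto simp: square_integrable_def)
  define h where "h k x = 4^k * (cmod (v k x - v (Suc k) x))\<^sup>2" for k x
  have "(\<integral>\<^sup>+x. (\<Sum>k. ennreal (h k x)) \<partial>M) = (\<Sum>k. \<integral>\<^sup>+x. ennreal (h k x) \<partial>M)"
    by (intro nn_integral_suminf) (simp add: h_def)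
  also have "\<dots> = (\<Sum>k. ennreal (4^k * sq_norm M (\<lambda>x. v k x - v (Suc k) x)))"
    unfolding h_def
    by (simp add: ennreal_mult sq_norm_nonneg nn_integral_cmult nn)
  also have "\<dots> \<le> (\<Sum>k. ennreal (K * (1/4)^k))"
  proof (intro suminf_le ennreal_leI)
    fix k
    have "4^k * sq_norm M (\<lambda>x. v k x - v (Suc k) x) \<le> 4^k * (K * (1/16)^k)"
      by (intro mult_left_mono cauchy) auto
    also have "\<dots> = K * (4 * (1/16))^k"
      by (simp only: power_mult_distrib mult_ac)
    finally show "4^k * sq_norm M (\<lambda>x. v k x - v (Suc k) x) \<le> K * (1/4)^k" by simp
  qed auto
  also have "\<dots> = ennreal (\<Sum>k. K * (1/4)^k)"
    using \<open>K \<ge> 0\<close> by (intro suminf_ennreal2) (auto intro!: summable_mult summable_geometric)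
  finally have "(\<integral>\<^sup>+x. (\<Sum>k. ennreal (h k x)) \<partial>M) \<noteq> \<infinity>"
    by (auto simp: top_unique)
  then have "AE x in M. (\<Sum>k. ennreal (h k x)) \<noteq> \<infinity>"
    by (intro nn_integral_PInf_AE) (auto simp: h_def)
  then have conv: "AE x in M. convergent (\<lambda>k. v k x)"
  proof eventually_elim
    fix x assume "(\<Sum>k. ennreal (h k x)) \<noteq> \<infinity>"
    then have s: "summable (\<lambda>k. h k x)"
      by (intro summable_suminf_not_top) (auto simp: h_def)
    define S where "S = (\<Sum>k. h k x)"
    have hS: "h k x \<le> S" for k
      unfolding S_def using s sum_le_suminf[of "\<lambda>k. h k x" "{k}"] by (auto simp: h_def)
    have bd: "cmod (v (Suc k) x - v k x) \<le> sqrt S * (1/2)^k" for k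
    proof -
      have "(2^k * cmod (v k x - v (Suc k) x))\<^sup>2 = h k x"
        by (simp add: h_def power_mult_distrib power2_eq_square flip: power_mult_distrib)
      with hS[of k] have "2^k * cmod (v k x - v (Suc k) x) \<le> sqrt S"
        by (metis real_le_rsqrt)
      then show ?thesis
        by (simp add: norm_minus_commute field_simps power_one_over)
    qed
    have "summable (\<lambda>k. v (Suc k) x - v k x)"
      by (rule summable_comparison_test'[where g = "\<lambda>k. sqrt S * (1/2)^k" and N = 0])
        (auto intro!: summable_mult summable_geometric bd)
    then have "convergent (\<lambda>n. \<Sum>k<n. v (Suc k) x - v k x)"
      by (simp add: summable_iff_convergent)
    then have "convergent (\<lambda>n. v n x - v 0 x)"
      by (subst (asm) sum_lessThan_telescope)
    then show "convergent (\<lambda>k. v k x)"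
      using convergent_diff_const_right_iff by blast
  qed
  define g where "g x = lim (\<lambda>k. v k x)" for x
  have [measurable]: "g \<in> borel_measurable M"
    unfolding g_def by measurable
  have lim: "AE x in M. (\<lambda>k. v k x) \<longlonglongrightarrow> g x"
    using conv by eventually_elim (simp add: g_def convergent_LIMSEQ_iff)
  have fatou: "(\<integral>\<^sup>+x. ennreal ((cmod (v k x - g x))\<^sup>2) \<partial>M) \<le> ennreal (K * (1/16)^k)" for k
  proof -
    have "(\<integral>\<^sup>+x. ennreal ((cmod (v k x - g x))\<^sup>2) \<partial>M) =
        (\<integral>\<^sup>+x. liminf (\<lambda>l. ennreal ((cmod (v k x - v l x))\<^sup>2)) \<partial>M)"
    proof (intro nn_integral_cong_AE, use lim in eventually_elim)
      fix x assume "(\<lambda>k. v k x) \<longlonglongrightarrow> g x"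
      then have "(\<lambda>l. ennreal ((cmod (v k x - v l x))\<^sup>2)) \<longlonglongrightarrow> ennreal ((cmod (v k x - g x))\<^sup>2)"
        by (intro tendsto_intros)
      then show "ennreal ((cmod (v k x - g x))\<^sup>2) = liminf (\<lambda>l. ennreal ((cmod (v k x - v l x))\<^sup>2))"
        by (intro lim_imp_Liminf[symmetric]) auto
    qed
    also have "\<dots> \<le> liminf (\<lambda>l. \<integral>\<^sup>+x. ennreal ((cmod (v k x - v l x))\<^sup>2) \<partial>M)"
      by (intro nn_integral_liminf) auto
    also have "\<dots> \<le> liminf (\<lambda>l. ennreal (K * (1/16)^k))"
      unfolding nn
      by (intro Liminf_mono eventually_sequentiallyI[of k] ennreal_leI cauchy)
    finally show ?thesis by (simp add: Liminf_const)
  qed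
  have d: "square_integrable M (\<lambda>x. v k x - g x)" for k
    using fatou[of k] unfolding square_integrable_def
    by (auto simp: integrable_iff_bounded intro: le_less_trans)
  show ?thesis
  proof
    show "square_integrable M g"
      using square_integrable_diff[OF v[of 0] d[of 0]] by simp
    fix k
    have "ennreal (sq_norm M (\<lambda>x. v k x - g x)) \<le> ennreal (K * (1/16)^k)"
      using fatou[of k] d[of k] unfolding sq_norm_def square_integrable_def
      by (subst (asm) nn_integral_eq_integral) auto
    then show "sq_norm M (\<lambda>x. v k x - g x) \<le> K * (1/16)^k"
      using \<open>K \<ge> 0\<close> by (subst (asm) ennreal_le_iff) auto
  qed
qed

lemma tendsto_integral_mult:
  assumes v: "\<And>k. square_integrable M (v k)" and f: "square_integrable M f"
    and g: "square_integrable M g"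
    and lim: "(\<lambda>k. sq_norm M (\<lambda>x. v k x - f x)) \<longlonglongrightarrow> 0"
  shows "(\<lambda>k. \<integral>x. g x * v k x \<partial>M) \<longlonglongrightarrow> (\<integral>x. g x * f x \<partial>M)"
proof -
  have "(cmod ((\<integral>x. g x * v k x \<partial>M) - (\<integral>x. g x * f x \<partial>M)))\<^sup>2
      \<le> sq_norm M g * sq_norm M (\<lambda>x. v k x - f x)" for k
  proof -
    have "(\<integral>x. g x * v k x \<partial>M) - (\<integral>x. g x * f x \<partial>M) = (\<integral>x. g x * (v k x - f x) \<partial>M)"
      using square_integrable_mult[OF g v, of k] square_integrable_mult[OF g f]
      by (simp add: algebra_simps)
    then show ?thesis
      using cauchy_schwarz_integral[OF g square_integrable_diff[OF v f]] by simp
  qed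
  then have le: "\<forall>\<^sub>F k in sequentially. norm ((cmod ((\<integral>x. g x * v k x \<partial>M) - (\<integral>x. g x * f x \<partial>M)))\<^sup>2)
      \<le> sq_norm M g * sq_norm M (\<lambda>x. v k x - f x)"
    by (intro always_eventually) simp
  have "(\<lambda>k. (cmod ((\<integral>x. g x * v k x \<partial>M) - (\<integral>x. g x * f x \<partial>M)))\<^sup>2) \<longlonglongrightarrow> 0"
    by (rule Lim_null_comparison[OF le tendsto_mult_right_zero[OF lim]])
  then have "(\<lambda>k. (\<integral>x. g x * v k x \<partial>M) - (\<integral>x. g x * f x \<partial>M)) \<longlonglongrightarrow> 0"
    by (simp add: tendsto_norm_zero_iff)
  then show ?thesis
    by (rule Lim_null[THEN iffD2])
qed

lemma tendsto_sq_norm: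
  assumes v: "\<And>k. square_integrable M (v k)" and f: "square_integrable M f"
    and lim: "(\<lambda>k. sq_norm M (\<lambda>x. v k x - f x)) \<longlonglongrightarrow> 0"
  shows "(\<lambda>k. sq_norm M (v k)) \<longlonglongrightarrow> sq_norm M f"
proof -
  have "sq_norm M (v k) = sq_norm M (\<lambda>x. v k x - f x) - sq_norm M f
      + 2 * Re (\<integral>x. cnj (f x) * v k x \<partial>M)" for k
    using sq_norm_diff[OF v[of k] f] by (simp add: mult.commute)
  moreover have "(\<lambda>k. sq_norm M (\<lambda>x. v k x - f x) - sq_norm M f
      + 2 * Re (\<integral>x. cnj (f x) * v k x \<partial>M)) \<longlonglongrightarrow> 0 - sq_norm M f + 2 * Re (\<integral>x. cnj (f x) * f x \<partial>M)"
    by (intro tendsto_intros lim tendsto_integral_mult v f square_integrable_cnj)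
  moreover have "Re (\<integral>x. cnj (f x) * f x \<partial>M) = sq_norm M f"
    using integral_mult_cnj_self[of M f] by (simp add: mult.commute)
  ultimately show ?thesis by simp
qed

text \<open>
  The Riesz representation theorem for a bounded linear functional on a subspace of \<open>L\<^sup>2\<close> that need not
  be closed. The functional is given by its graph \<open>G\<close>: in the application its argument is
  \<open>(\<Delta> + l) \<phi>\<close> while its value is expressed in terms of \<open>\<phi>\<close>, and a graph avoids choosing a preimage.

  The proof minimises the energy \<open>\<parallel>v\<parallel>\<^sup>2 - 2 Re c\<close> over \<open>G\<close>. By the parallelogram law a minimising sequence
  is Cauchy. The first variation at its limit \<open>w\<close> says that \<open>cnj w\<close> represents the functional on \<open>G\<close>;
  the limit itself may lie outside the subspace.
\<close>

lemma riesz_representation_graph: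
  fixes G :: "(('a \<Rightarrow> complex) \<times> complex) set"
  assumes "G \<noteq> {}" and "0 \<le> C"
    and sq: "\<And>v c. (v, c) \<in> G \<Longrightarrow> square_integrable M v"
    and add: "\<And>v c v' c'. (v, c) \<in> G \<Longrightarrow> (v', c') \<in> G \<Longrightarrow> (\<lambda>x. v x + v' x, c + c') \<in> G"
    and scale: "\<And>v c z. (v, c) \<in> G \<Longrightarrow> (\<lambda>x. z * v x, z * c) \<in> G"
    and bound: "\<And>v c. (v, c) \<in> G \<Longrightarrow> (cmod c)\<^sup>2 \<le> C * sq_norm M v"
  obtains u where "square_integrable M u" "sq_norm M u \<le> C"
    "\<And>v c. (v, c) \<in> G \<Longrightarrow> c = (\<integral>x. u x * v x \<partial>M)"
proof -
  define J where "J = (\<lambda>(v, c). sq_norm M v - 2 * Re c)"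
  define d where "d = Inf (J ` G)"
  have "- C \<le> J p" if "p \<in> G" for p
  proof -
    obtain v c where p: "p = (v, c)" by fastforce
    have "(cmod c)\<^sup>2 \<le> C * sq_norm M v" using bound that p by simp
    also have "\<dots> \<le> ((C + sq_norm M v) / 2)\<^sup>2"
      using zero_le_power2[of "C - sq_norm M v"] by (simp add: power2_eq_square field_simps)
    finally have "cmod c \<le> (C + sq_norm M v) / 2"
      by (rule power2_le_imp_le) (use \<open>0 \<le> C\<close> sq_norm_nonneg[of M v] in auto)
    moreover have "Re c \<le> cmod c" by (rule complex_Re_le_cmod)
    ultimately show ?thesis unfolding p J_def by simp
  qed
  then have bdd: "bdd_below (J ` G)" by (intro bdd_belowI2)
  then have d: "d \<le> J p" if "p \<in> G" for p
    unfolding d_def using that by (rule cINF_lower)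
  \<comment> \<open>The rate \<open>16\<^sup>-\<^sup>k\<close> is the one that \<open>L2_complete\<close> asks for.\<close>
  have "\<exists>p\<in>G. J p < d + (1/16)^k" for k :: nat
    using cINF_less_iff[OF \<open>G \<noteq> {}\<close> bdd, of "d + (1/16)^k"] unfolding d_def by simp
  then obtain p where p: "\<And>k::nat. p k \<in> G" "\<And>k. J (p k) < d + (1/16)^k" by metis
  define v where "v k = fst (p k)" for k
  define c where "c k = snd (p k)" for k
  have vc: "(v k, c k) \<in> G" for k using p by (simp add: v_def c_def)
  have Jvc: "sq_norm M (v k) - 2 * Re (c k) < d + (1/16)^k" for k
    using p(2)[of k] by (simp add: J_def v_def c_def split_beta)
  have sqv: "square_integrable M (v k)" for k using sq vc by blast
  have cauchy: "sq_norm M (\<lambda>x. v k x - v l x) \<le> 4 * (1/16)^k" if "k \<le> l" for k l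
  proof -
    have "(\<lambda>x. (1/2) * (v k x + v l x), (1/2) * (c k + c l)) \<in> G"
      using scale[OF add[OF vc vc]] .
    from d[OF this] have "d \<le> sq_norm M (\<lambda>x. v k x + v l x) / 4 - Re (c k) - Re (c l)"
      using sq_norm_cmult[of M "1/2" "\<lambda>x. v k x + v l x"] by (simp add: J_def power2_eq_square field_simps)
    moreover have "sq_norm M (\<lambda>x. v k x - v l x) + sq_norm M (\<lambda>x. v k x + v l x)
       = 2 * sq_norm M (v k) + 2 * sq_norm M (v l)"
      using sq_norm_add[OF sqv sqv, of k l] sq_norm_diff[OF sqv sqv, of k l] by simp
    moreover have "(1/16::real)^l \<le> (1/16)^k"
      using that by (intro power_decreasing) auto
    ultimately show ?thesis
      using Jvc[of k] Jvc[of l] by linarith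
  qed
  obtain w where w: "square_integrable M w"
    and lim_w: "\<And>k. sq_norm M (\<lambda>x. v k x - w x) \<le> 4 * (1/16)^k"
    using L2_complete[OF sqv cauchy] by blast
  have pow0: "(\<lambda>k. (1/16::real)^k) \<longlonglongrightarrow> 0" by (intro LIMSEQ_realpow_zero) auto
  have lim: "(\<lambda>k. sq_norm M (\<lambda>x. v k x - w x)) \<longlonglongrightarrow> 0"
    by (rule Lim_null_comparison[OF always_eventually tendsto_mult_right_zero[OF pow0, of 4]])
      (simp add: sq_norm_nonneg lim_w)
  have rep: "b = (\<integral>x. cnj (w x) * f x \<partial>M)" if fb: "(f, b) \<in> G" for f b
  proof -
    have f: "square_integrable M f" using sq fb .
    define S where "S = (\<integral>x. cnj (w x) * f x \<partial>M)"
    have S': "(\<integral>x. cnj (f x) * w x \<partial>M) = cnj S"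
      unfolding S_def Bochner_Integration.integral_cnj[symmetric] by (simp add: mult.commute)
    have var: "0 \<le> (cmod z)\<^sup>2 * sq_norm M f + 2 * Re (z * (S - b))" for z
    proof (rule LIMSEQ_le_const)
      show "\<exists>N. \<forall>k\<ge>N. 0 \<le> (1/16)^k + (cmod z)\<^sup>2 * sq_norm M f
          + 2 * Re (cnj z * (\<integral>x. cnj (f x) * v k x \<partial>M)) - 2 * Re (z * b)"
      proof (intro exI allI impI)
        fix k
        have "(\<lambda>x. v k x + z * f x, c k + z * b) \<in> G" using add[OF vc scale[OF fb]] .
        from d[OF this] have "d \<le> sq_norm M (\<lambda>x. v k x + z * f x) - 2 * Re (c k + z * b)"
          by (simp add: J_def)
        also have "sq_norm M (\<lambda>x. v k x + z * f x) = sq_norm M (v k) + (cmod z)\<^sup>2 * sq_norm M f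
            + 2 * Re (\<integral>x. v k x * cnj (z * f x) \<partial>M)"
          using sq_norm_add[OF sqv square_integrable_cmult[OF f]] by (simp only: sq_norm_cmult)
        also have "(\<integral>x. v k x * cnj (z * f x) \<partial>M) = (\<integral>x. cnj z * (cnj (f x) * v k x) \<partial>M)"
          by (simp add: mult_ac)
        also have "\<dots> = cnj z * (\<integral>x. cnj (f x) * v k x \<partial>M)"
          by (rule integral_mult_right_zero)
        finally show "0 \<le> (1/16)^k + (cmod z)\<^sup>2 * sq_norm M f
          + 2 * Re (cnj z * (\<integral>x. cnj (f x) * v k x \<partial>M)) - 2 * Re (z * b)"
          using Jvc[of k] by (simp del: times_complex.sel)
      qed
      have "(\<lambda>k. (1/16)^k + (cmod z)\<^sup>2 * sq_norm M f
          + 2 * Re (cnj z * (\<integral>x. cnj (f x) * v k x \<partial>M)) - 2 * Re (z * b)) \<longlonglongrightarrow>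
         0 + (cmod z)\<^sup>2 * sq_norm M f + 2 * Re (cnj z * (\<integral>x. cnj (f x) * w x \<partial>M)) - 2 * Re (z * b)"
        by (intro tendsto_intros pow0 tendsto_integral_mult sqv w f square_integrable_cnj lim)
      then show "(\<lambda>k. (1/16)^k + (cmod z)\<^sup>2 * sq_norm M f
          + 2 * Re (cnj z * (\<integral>x. cnj (f x) * v k x \<partial>M)) - 2 * Re (z * b)) \<longlonglongrightarrow>
          (cmod z)\<^sup>2 * sq_norm M f + 2 * Re (z * (S - b))"
        unfolding S' by (simp add: algebra_simps)
    qed
    define W where "W = sq_norm M f"
    have "W \<ge> 0" by (simp add: W_def sq_norm_nonneg)
    \<comment> \<open>A step against \<open>S - b\<close>, short enough for the linear term of the variation to win.\<close>
    define t where "t = 1 / (W + 1)"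
    have t: "0 < t" "t * W < 1" using \<open>W \<ge> 0\<close> by (auto simp: t_def field_simps)
    have re: "Re ((- of_real t * cnj (S - b)) * (S - b)) = - t * (cmod (S - b))\<^sup>2"
      unfolding cmod_power2 by (simp add: power2_eq_square algebra_simps)
    have sq_z: "(cmod (- of_real t * cnj (S - b)))\<^sup>2 = t\<^sup>2 * (cmod (S - b))\<^sup>2"
      unfolding norm_mult complex_mod_cnj by (simp add: power_mult_distrib)
    have "0 \<le> t\<^sup>2 * (cmod (S - b))\<^sup>2 * W - 2 * (t * (cmod (S - b))\<^sup>2)"
      using var[of "- of_real t * cnj (S - b)"] unfolding W_def[symmetric] re sq_z by simp
    then have "0 \<le> (t * (cmod (S - b))\<^sup>2) * (t * W - 2)"
      by (simp add: power2_eq_square algebra_simps)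
    with t have "t * (cmod (S - b))\<^sup>2 \<le> 0"
      by (smt (verit) mult_pos_neg)
    with t have "cmod (S - b) = 0"
      by (simp add: mult_le_0_iff)
    then show ?thesis by (simp add: S_def)
  qed
  define N where "N = sq_norm M w"
  \<comment> \<open>The functional takes the value \<open>\<parallel>w\<parallel>\<^sup>2\<close> in the limit along the minimising sequence.\<close>
  have "N\<^sup>2 \<le> C * N"
  proof (rule LIMSEQ_le)
    have ww: "(\<integral>x. cnj (w x) * w x \<partial>M) = of_real N"
      using integral_mult_cnj_self[of M w] by (simp add: mult.commute N_def)
    have "c k = (\<integral>x. cnj (w x) * v k x \<partial>M)" for k
      by (rule rep[OF vc])
    then have c_eq: "c = (\<lambda>k. \<integral>x. cnj (w x) * v k x \<partial>M)" by (rule ext)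
    have "c \<longlonglongrightarrow> of_real N"
      unfolding c_eq ww[symmetric]
      by (rule tendsto_integral_mult[OF sqv w square_integrable_cnj[OF w] lim])
    then have "(\<lambda>k. (cmod (c k))\<^sup>2) \<longlonglongrightarrow> (cmod (of_real N))\<^sup>2"
      by (intro tendsto_intros)
    then show "(\<lambda>k. (cmod (c k))\<^sup>2) \<longlonglongrightarrow> N\<^sup>2" by simp
    show "(\<lambda>k. C * sq_norm M (v k)) \<longlonglongrightarrow> C * N"
      unfolding N_def by (intro tendsto_intros tendsto_sq_norm sqv w lim)
    show "\<exists>n. \<forall>k\<ge>n. (cmod (c k))\<^sup>2 \<le> C * sq_norm M (v k)"
      using bound vc by blast
  qed
  then have "N \<le> C"
    using \<open>0 \<le> C\<close> by (cases "N > 0") (auto simp: power2_eq_square)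
  moreover have "sq_norm M (\<lambda>x. cnj (w x)) = N" by (simp add: N_def sq_norm_def)
  ultimately show ?thesis
    using that[OF square_integrable_cnj[OF w]] rep by simp
qed

section \<open>Integration by parts and the weighted inner product\<close>

lemma integrable_compact_support:
  fixes g :: "real ^ 'n::finite \<Rightarrow> 'b::{banach, second_countable_topology}"
  assumes cont: "continuous_on UNIV g" and zero: "\<And>x. norm x \<ge> R \<Longrightarrow> g x = 0"
  shows "integrable lborel g"
proof -
  have "integrable lborel (\<lambda>x. indicator (cball 0 R) x *\<^sub>R g x)"
    by (intro borel_integrable_compact continuous_on_subset[OF cont]) auto
  moreover have "(\<lambda>x. indicator (cball 0 R) x *\<^sub>R g x) = g"
    using zero by (auto simp: indicator_def fun_eq_iff)
  ultimately show ?thesis by simp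
qed

lemma integral_translation:
  fixes g :: "real ^ 'n::finite \<Rightarrow> complex"
  assumes "g \<in> borel_measurable borel"
  shows "(\<integral>x. g (x + a) \<partial>lborel) = (\<integral>x. g x \<partial>lborel)"
proof -
  have "(\<integral>x. g x \<partial>lborel) = (\<integral>x. g x \<partial>(distr lborel borel ((+) a)))"
    by (simp add: lborel_distr_plus)
  also have "\<dots> = (\<integral>x. g (a + x) \<partial>lborel)"
    using assms by (intro integral_distr) auto
  finally show ?thesis by (simp add: add.commute)
qed

text \<open>
  The integrals of the difference quotients of \<open>g\<close> in direction \<open>e\<^sub>j\<close> vanish because Lebesgue measure is
  translation invariant. By the mean value inequality the quotients are bounded by a multiple of the
  indicator of a ball, so dominated convergence gives the claim without iterated integrals.
\<close>

lemma integral_partial_deriv_eq_0: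
  fixes g :: "real ^ 'n::finite \<Rightarrow> complex"
  assumes diff: "\<And>x. g differentiable (at x)"
    and cont: "continuous_on UNIV (partial_deriv j g)"
    and zero: "\<And>x. norm x \<ge> R \<Longrightarrow> g x = 0"
  shows "(\<integral>x. partial_deriv j g x \<partial>lebesgue) = 0"
proof -
  define e where "e = (axis j 1 :: real^'n)"
  have [simp]: "norm e = 1" by (simp add: e_def norm_axis_1)
  have contg: "continuous_on UNIV g"
    using diff by (simp add: continuous_on_eq_continuous_within differentiable_imp_continuous_within)
  have [measurable]: "g \<in> borel_measurable borel" "partial_deriv j g \<in> borel_measurable borel"
    using cont contg by (auto intro: borel_measurable_continuous_onI)
  have intg: "integrable lborel g" by (rule integrable_compact_support[OF contg zero])
  have deriv: "((\<lambda>t. g (x + t *\<^sub>R e)) has_vector_derivative partial_deriv j g (x + s *\<^sub>R e)) (at s within S)"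
    for x s S
    unfolding e_def by (rule has_vector_derivative_line[OF diff])
  define t where "t k = inverse (real (Suc k))" for k
  have t: "0 < t k" "t k \<le> 1" for k by (auto simp: t_def field_simps)
  have "bounded (partial_deriv j g ` cball 0 (R + 2))"
    by (intro compact_imp_bounded compact_continuous_image continuous_on_subset[OF cont]) auto
  then obtain M where "\<forall>x\<in>cball 0 (R + 2). norm (partial_deriv j g x) \<le> M"
    by (auto simp: bounded_iff)
  then have M: "norm x \<le> R + 2 \<Longrightarrow> norm (partial_deriv j g x) \<le> M" for x
    by simp
  define q where "q k x = (g (x + t k *\<^sub>R e) - g x) /\<^sub>R t k" for k x
  have bound: "norm (q k x) \<le> indicator (cball 0 (R + 1)) x *\<^sub>R M" for k x
  proof (cases "norm x \<le> R + 1")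
    case True
    have "norm (g (x + t k *\<^sub>R e) - g (x + 0 *\<^sub>R e)) \<le> M * norm (t k - 0)"
    proof (rule differentiable_bound[where S = "{0..1}"])
      fix s :: real assume s: "s \<in> {0..1}"
      show "((\<lambda>t. g (x + t *\<^sub>R e)) has_derivative (\<lambda>h. h *\<^sub>R partial_deriv j g (x + s *\<^sub>R e))) (at s within {0..1})"
        using deriv by (simp add: has_vector_derivative_def)
      have "norm (x + s *\<^sub>R e) \<le> R + 2"
        using norm_triangle_ineq[of x "s *\<^sub>R e"] s True by simp
      then have "norm (partial_deriv j g (x + s *\<^sub>R e)) \<le> M" by (rule M)
      then show "onorm (\<lambda>h. h *\<^sub>R partial_deriv j g (x + s *\<^sub>R e)) \<le> M"
        by (intro onorm_le) (simp add: mult.commute[of M] mult_left_mono)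
    qed (use t[of k] in auto)
    moreover have "norm (q k x) = norm (g (x + t k *\<^sub>R e) - g x) / t k"
      using t[of k] by (simp add: q_def divide_inverse mult.commute)
    ultimately show ?thesis
      using t[of k] True by (simp add: pos_divide_le_eq)
  next
    case False
    have "norm x \<le> norm (x + t k *\<^sub>R e) + norm (t k *\<^sub>R e)"
      using norm_triangle_ineq4[of "x + t k *\<^sub>R e" "t k *\<^sub>R e"] by simp
    with False t[of k] have "norm (x + t k *\<^sub>R e) \<ge> R" "norm x \<ge> R" by auto
    then show ?thesis using False by (simp add: q_def zero)
  qed
  have lim: "(\<lambda>k. q k x) \<longlonglongrightarrow> partial_deriv j g x" for x
  proof -
    have "((\<lambda>h. norm (g (x + (0 + h) *\<^sub>R e) - g (x + 0 *\<^sub>R e) - h *\<^sub>R partial_deriv j g (x + 0 *\<^sub>R e)) / norm h)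
        \<longlongrightarrow> 0) (at 0)"
      using deriv[of x 0 UNIV] unfolding has_vector_derivative_def has_derivative_at by blast
    moreover have "filterlim t (at 0) sequentially"
      unfolding filterlim_at using t LIMSEQ_inverse_real_of_nat
      by (auto simp: t_def[abs_def] less_imp_neq[symmetric])
    ultimately have "(\<lambda>k. norm (g (x + (0 + t k) *\<^sub>R e) - g (x + 0 *\<^sub>R e) - t k *\<^sub>R partial_deriv j g (x + 0 *\<^sub>R e)) / norm (t k))
        \<longlonglongrightarrow> 0"
      by (rule filterlim_compose)
    moreover have "norm (g (x + (0 + t k) *\<^sub>R e) - g (x + 0 *\<^sub>R e) - t k *\<^sub>R partial_deriv j g (x + 0 *\<^sub>R e)) / norm (t k)
        = norm (q k x - partial_deriv j g x)" for k
    proof -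
      have "q k x - partial_deriv j g x =
          (g (x + t k *\<^sub>R e) - g x - t k *\<^sub>R partial_deriv j g x) /\<^sub>R t k"
        using t[of k] by (simp add: q_def scaleR_diff_right)
      then show ?thesis
        using t[of k] by (simp add: divide_inverse mult.commute)
    qed
    ultimately have "(\<lambda>k. norm (q k x - partial_deriv j g x)) \<longlonglongrightarrow> 0" by simp
    then show ?thesis
      unfolding tendsto_norm_zero_iff by (rule Lim_null[THEN iffD2])
  qed
  have "(\<lambda>k. \<integral>x. q k x \<partial>lborel) \<longlonglongrightarrow> (\<integral>x. partial_deriv j g x \<partial>lborel)"
  proof (rule integral_dominated_convergence)
    show "integrable lborel (\<lambda>x::real^'n. indicator (cball 0 (R + 1)) x *\<^sub>R M)"
      by (intro borel_integrable_compact) auto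
    show "q k \<in> borel_measurable lborel" for k unfolding q_def by measurable
  qed (use lim bound in auto)
  moreover have "(\<integral>x. q k x \<partial>lborel) = 0" for k
  proof -
    have "integrable lborel (\<lambda>x. g (x + t k *\<^sub>R e))"
    proof (rule integrable_compact_support[where R = "R + 1"])
      show "continuous_on UNIV (\<lambda>x. g (x + t k *\<^sub>R e))"
        by (intro continuous_on_compose2[OF contg]) (auto intro!: continuous_intros)
      fix x :: "real^'n" assume "norm x \<ge> R + 1"
      moreover have "norm x \<le> norm (x + t k *\<^sub>R e) + norm (t k *\<^sub>R e)"
        using norm_triangle_ineq4[of "x + t k *\<^sub>R e" "t k *\<^sub>R e"] by simp
      ultimately show "g (x + t k *\<^sub>R e) = 0" using t[of k] by (intro zero) simp
    qed
    then show ?thesis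
      using intg by (simp add: q_def integral_translation)
  qed
  ultimately have "(\<integral>x. partial_deriv j g x \<partial>lborel) = 0"
    by (simp add: LIMSEQ_const_iff)
  then show ?thesis by (simp add: integral_completion)
qed

text \<open>
  Multiplication by \<open>\<surd>W\<close>, where \<open>W x = exp (\<bar>x\<bar>\<^sup>2)\<close>, identifies the \<open>L\<^sup>2\<close> space with weight \<open>W\<close> with the unweighted
  one, to which the facts about square integrable functions apply.
\<close>

definition half_weighted :: "(real ^ 'n::finite \<Rightarrow> complex) \<Rightarrow> real ^ 'n \<Rightarrow> complex" where
  "half_weighted f x = of_real (exp ((norm x)\<^sup>2 / 2)) * f x"

definition gauss_inner :: "(real ^ 'n::finite \<Rightarrow> complex) \<Rightarrow> (real ^ 'n \<Rightarrow> complex) \<Rightarrow> complex" where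
  "gauss_inner f g = (\<integral>x. half_weighted f x * cnj (half_weighted g x) \<partial>lebesgue)"

text \<open>
  This is \<open>- W\<^sup>-\<^sup>1 \<partial>\<^sub>j (W f)\<close>, the adjoint of \<open>\<partial>\<^sub>j\<close> for the weight \<open>W\<close>.
\<close>

definition adj_deriv :: "'n::finite \<Rightarrow> (real ^ 'n \<Rightarrow> complex) \<Rightarrow> real ^ 'n \<Rightarrow> complex" where
  "adj_deriv j f x = - (partial_deriv j f x + 2 * of_real (x $ j) * f x)"

lemma half_weighted_mult_cnj:
  "half_weighted f x * cnj (half_weighted g x) = f x * cnj (g x) * of_real (exp (x \<bullet> x))"
proof -
  let ?E = "complex_of_real (exp ((norm x)\<^sup>2 / 2))"
  have "exp ((norm x)\<^sup>2 / 2) * exp ((norm x)\<^sup>2 / 2) = exp (x \<bullet> x)"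
    by (simp flip: exp_add power2_norm_eq_inner)
  then have "?E * ?E = of_real (exp (x \<bullet> x))"
    by (metis of_real_mult)
  moreover have "half_weighted f x * cnj (half_weighted g x) = f x * cnj (g x) * (?E * ?E)"
    by (simp add: half_weighted_def)
  ultimately show ?thesis by simp
qed

lemma square_integrable_half_weighted:
  assumes "test_function f"
  shows "square_integrable lebesgue (half_weighted f)"
proof -
  obtain R where R: "\<And>x. norm x \<ge> R \<Longrightarrow> f x = 0" and f: "smooth f"
    using assms by (auto simp: test_function_iff)
  have cont: "continuous_on UNIV (half_weighted f)"
    unfolding half_weighted_def by (intro continuous_intros smooth_continuous f) auto
  have "integrable lborel (\<lambda>x. (cmod (half_weighted f x))\<^sup>2)"
    by (rule integrable_compact_support[where R = R], intro continuous_intros cont) (simp add: half_weighted_def R)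
  moreover have "half_weighted f \<in> borel_measurable borel"
    using cont by (rule borel_measurable_continuous_onI)
  ultimately show ?thesis
    by (auto simp: square_integrable_def integrable_completion intro: measurable_completion)
qed

lemma half_weighted_add: "half_weighted (\<lambda>x. f x + g x) = (\<lambda>x. half_weighted f x + half_weighted g x)"
  by (simp add: half_weighted_def fun_eq_iff algebra_simps)

lemma half_weighted_cmult: "half_weighted (\<lambda>x. c * f x) = (\<lambda>x. c * half_weighted f x)"
  by (simp add: half_weighted_def fun_eq_iff)

lemma gauss_inner_cnj: "cnj (gauss_inner f g) = gauss_inner g f"
  unfolding gauss_inner_def Bochner_Integration.integral_cnj[symmetric] by (simp add: mult.commute)

lemma gauss_inner_add_left:
  assumes "test_function f" "test_function g" "test_function h"
  shows "gauss_inner (\<lambda>x. f x + g x) h = gauss_inner f h + gauss_inner g h"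
  unfolding gauss_inner_def half_weighted_add distrib_right
  by (intro Bochner_Integration.integral_add square_integrable_mult square_integrable_cnj
      square_integrable_half_weighted assms)

lemma gauss_inner_cmult_left: "gauss_inner (\<lambda>x. c * f x) h = c * gauss_inner f h"
  unfolding gauss_inner_def half_weighted_cmult mult.assoc by (rule integral_mult_right_zero)

lemma gauss_inner_sum_left:
  assumes "\<And>i. i \<in> I \<Longrightarrow> test_function (f i)" "test_function h"
  shows "gauss_inner (\<lambda>x. \<Sum>i\<in>I. f i x) h = (\<Sum>i\<in>I. gauss_inner (f i) h)"
  using assms(1)
proof (induction I rule: infinite_finite_induct)
  case (insert i I)
  then show ?case
    by (simp add: gauss_inner_add_left test_function_sum assms(2))
qed (simp_all add: gauss_inner_def half_weighted_def)

lemma gauss_inner_sum_right: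
  assumes "\<And>i. i \<in> I \<Longrightarrow> test_function (f i)" "test_function h"
  shows "gauss_inner h (\<lambda>x. \<Sum>i\<in>I. f i x) = (\<Sum>i\<in>I. gauss_inner h (f i))"
  using arg_cong[OF gauss_inner_sum_left[OF assms], where f = cnj] by (simp add: gauss_inner_cnj)

lemma gauss_inner_self: "Re (gauss_inner f f) = sq_norm lebesgue (half_weighted f)"
  by (simp only: gauss_inner_def integral_mult_cnj_self Re_complex_of_real)

lemma test_function_adj_deriv:
  assumes "test_function f"
  shows "test_function (adj_deriv j f)"
proof -
  have "adj_deriv j f = (\<lambda>x. (-1) * partial_deriv j f x + (-2) * (of_real (x $ j) * f x))"
    by (simp add: adj_deriv_def fun_eq_iff)
  then show ?thesis
    using assms by (simp only: test_function_add test_function_cmult test_function_partial_deriv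
        test_function_coord_mult)
qed

text \<open>
  Integration by parts: the difference of the two integrands is the \<open>j\<close>-th partial derivative of
  \<open>f * cnj g * W\<close>, which has compact support.
\<close>

lemma gauss_inner_partial_deriv_left:
  assumes f: "test_function f" and g: "test_function g"
  shows "gauss_inner (partial_deriv j f) g = gauss_inner f (adj_deriv j g)"
proof -
  let ?W = "\<lambda>x::real^'a. complex_of_real (exp (x \<bullet> x))"
  let ?p = "\<lambda>x. f x * cnj (g x) * ?W x"
  obtain R where R: "\<And>x. norm x \<ge> R \<Longrightarrow> f x = 0" using f by (auto simp: test_function_iff)
  have sm: "smooth f" "smooth g" using f g by (auto intro: test_function_smooth)
  have W: "(?W has_derivative (\<lambda>h. of_real (exp (x \<bullet> x) * (2 * (x \<bullet> h))))) (at x)" for x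
    by (auto intro!: derivative_eq_intros simp: inner_commute)
  have d: "(?p has_derivative (\<lambda>h. f x * cnj (g x) * of_real (exp (x \<bullet> x) * (2 * (x \<bullet> h))) +
     (f x * cnj (frechet_derivative g (at x) h) + frechet_derivative f (at x) h * cnj (g x)) * ?W x)) (at x)" for x
    by (intro has_derivative_mult W sm[THEN smooth_has_derivative]
        bounded_linear.has_derivative[OF bounded_linear_cnj])
  have pd: "partial_deriv j ?p x =
      half_weighted (partial_deriv j f) x * cnj (half_weighted g x) -
      half_weighted f x * cnj (half_weighted (adj_deriv j g) x)" for x
    unfolding partial_deriv_eq[OF d] half_weighted_mult_cnj
    by (simp add: sm[THEN smooth_has_derivative, THEN partial_deriv_eq] adj_deriv_def inner_axis algebra_simps)
  have "(\<integral>x. partial_deriv j ?p x \<partial>lebesgue) = 0"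
  proof (rule integral_partial_deriv_eq_0)
    show "?p differentiable (at x)" for x using d by (auto simp: differentiable_def)
    show "continuous_on UNIV (partial_deriv j ?p)"
      unfolding pd[abs_def] half_weighted_mult_cnj adj_deriv_def
      by (intro continuous_intros smooth_continuous smooth_partial_deriv sm)
    show "?p x = 0" if "norm x \<ge> R" for x using R[OF that] by simp
  qed
  also have "(\<integral>x. partial_deriv j ?p x \<partial>lebesgue) = gauss_inner (partial_deriv j f) g - gauss_inner f (adj_deriv j g)"
    unfolding pd gauss_inner_def
    by (intro Bochner_Integration.integral_diff square_integrable_mult square_integrable_cnj
      square_integrable_half_weighted test_function_adj_deriv test_function_partial_deriv f g)
  finally show ?thesis by simp
qed

lemma gauss_inner_adj_deriv_left:
  assumes "test_function f" "test_function g"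
  shows "gauss_inner (adj_deriv j f) g = gauss_inner f (partial_deriv j g)"
  using arg_cong[OF gauss_inner_partial_deriv_left[OF assms(2,1)], where f = cnj] by (simp add: gauss_inner_cnj)

text \<open>
  The canonical commutation relation. The commutator comes only from \<open>\<partial>\<^sub>j\<close> hitting the factor \<open>2 x\<^sub>i\<close>,
  since partial derivatives commute.
\<close>

lemma adj_deriv_partial_deriv:
  assumes "smooth f"
  shows "adj_deriv i (partial_deriv j f) =
    (\<lambda>x. partial_deriv j (adj_deriv i f) x + (if i = j then 2 else 0) * f x)"
proof
  fix x
  have "adj_deriv i f = (\<lambda>x. (-1) * partial_deriv i f x + (-2) * (of_real (x $ i) * f x))"
    by (simp add: adj_deriv_def fun_eq_iff)
  then have eq: "partial_deriv j (adj_deriv i f) x = - partial_deriv j (partial_deriv i f) x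
      - 2 * ((if i = j then f x else 0) + of_real (x $ i) * partial_deriv j f x)"
    by (simp only: partial_deriv_add[OF smooth_cmult[OF smooth_partial_deriv[OF assms]]
          smooth_cmult[OF smooth_coord_mult[OF assms]]]
        partial_deriv_cmult[OF smooth_partial_deriv[OF assms]]
        partial_deriv_cmult[OF smooth_coord_mult[OF assms]] partial_deriv_coord_mult[OF assms]) simp
  show "adj_deriv i (partial_deriv j f) x =
      partial_deriv j (adj_deriv i f) x + (if i = j then 2 else 0) * f x"
    unfolding eq adj_deriv_def[of i "partial_deriv j f"] partial_deriv_commute[OF assms, of i j x]
    by (simp add: algebra_simps)
qed

section \<open>The lower bound for the shifted Laplacian\<close>

lemma partial_deriv_add_cmult:
  assumes "test_function f" "test_function g"
  shows "partial_deriv j (\<lambda>x. f x + c * g x) = (\<lambda>x. partial_deriv j f x + c * partial_deriv j g x)"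
  using assms[THEN test_function_smooth]
  by (simp add: fun_eq_iff partial_deriv_add partial_deriv_cmult smooth_cmult)

lemma adj_deriv_add_cmult:
  assumes "test_function f" "test_function g"
  shows "adj_deriv j (\<lambda>x. f x + c * g x) = (\<lambda>x. adj_deriv j f x + c * adj_deriv j g x)"
  by (simp add: fun_eq_iff adj_deriv_def partial_deriv_add_cmult[OF assms] algebra_simps)

text \<open>
  For \<open>i = j\<close>, write \<open>A\<close> for the derivative and \<open>B\<close> for its adjoint. From \<open>B A = A B + 2\<close> one gets
  \<open>B\<^sup>2 A = A B\<^sup>2 + 4 B\<close> and then \<open>B\<^sup>2 A\<^sup>2 = A\<^sup>2 B\<^sup>2 + 4 A B + 4 B A = A\<^sup>2 B\<^sup>2 + 8 A B + 8\<close>.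
\<close>

lemma adj_deriv_sq_partial_deriv_sq:
  assumes f: "test_function f"
  shows "adj_deriv i (adj_deriv i (partial_deriv j (partial_deriv j f))) =
    (\<lambda>x. partial_deriv j (partial_deriv j (adj_deriv i (adj_deriv i f))) x +
      (if i = j then 8 else 0) * (partial_deriv j (adj_deriv j f) x + f x))"
proof (cases "i = j")
  case False
  then have "adj_deriv i (partial_deriv j h) = partial_deriv j (adj_deriv i h)" if "test_function h" for h
    using adj_deriv_partial_deriv[OF test_function_smooth[OF that], of i j] by simp
  with False f show ?thesis
    by (simp add: test_function_partial_deriv test_function_adj_deriv)
next
  case True
  let ?A = "partial_deriv j" and ?B = "adj_deriv j"
  note T = test_function_partial_deriv test_function_adj_deriv f
  have c: "?B (?A h) = (\<lambda>x. ?A (?B h) x + 2 * h x)" if "test_function h" for h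
    using adj_deriv_partial_deriv[OF test_function_smooth[OF that], of j j] by simp
  have "?B (?B (?A f)) = (\<lambda>x. ?B (?A (?B f)) x + 2 * ?B f x)"
    unfolding c[OF f] by (rule adj_deriv_add_cmult) (intro T)+
  also have "\<dots> = (\<lambda>x. ?A (?B (?B f)) x + 4 * ?B f x)"
    by (subst c) (auto intro: T)
  finally have "?A (?B (?B (?A f))) = ?A (\<lambda>x. ?A (?B (?B f)) x + 4 * ?B f x)" by simp
  also have "\<dots> = (\<lambda>x. ?A (?A (?B (?B f))) x + 4 * ?A (?B f) x)"
    by (rule partial_deriv_add_cmult) (intro T)+
  finally have ABBA: "?A (?B (?B (?A f))) = (\<lambda>x. ?A (?A (?B (?B f))) x + 4 * ?A (?B f) x)" .
  have "?B (?B (?A (?A f))) = ?B (\<lambda>x. ?A (?B (?A f)) x + 2 * ?A f x)"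
    by (subst c) (auto intro: T)
  also have "\<dots> = (\<lambda>x. ?B (?A (?B (?A f))) x + 2 * ?B (?A f) x)"
    by (rule adj_deriv_add_cmult) (intro T)+
  also have "?B (?A (?B (?A f))) = (\<lambda>x. ?A (?B (?B (?A f))) x + 2 * ?B (?A f) x)"
    by (rule c) (intro T)
  finally have "?B (?B (?A (?A f))) = (\<lambda>x. ?A (?A (?B (?B f))) x + 4 * ?A (?B f) x + 4 * ?B (?A f) x)"
    unfolding ABBA by (simp add: fun_eq_iff)
  then show ?thesis
    using True unfolding c[OF f] by (simp add: fun_eq_iff algebra_simps)
qed

lemma gauss_inner_add_cmult_self:
  assumes "test_function f" "test_function g"
  shows "Re (gauss_inner (\<lambda>x. f x + c * g x) (\<lambda>x. f x + c * g x)) =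
    Re (gauss_inner f f) + (cmod c)\<^sup>2 * Re (gauss_inner g g) + 2 * Re (cnj c * gauss_inner f g)"
proof -
  have "(\<integral>x. half_weighted f x * cnj (c * half_weighted g x) \<partial>lebesgue) =
      (\<integral>x. cnj c * (half_weighted f x * cnj (half_weighted g x)) \<partial>lebesgue)"
    by (simp add: mult_ac)
  also have "\<dots> = cnj c * gauss_inner f g"
    unfolding gauss_inner_def by (rule integral_mult_right_zero)
  finally show ?thesis
    unfolding gauss_inner_self half_weighted_add half_weighted_cmult
    by (subst sq_norm_add) (simp_all only: sq_norm_cmult square_integrable_half_weighted assms
        square_integrable_cmult)
qed

lemma laplacian_eq: "laplacian f = (\<lambda>x. \<Sum>j\<in>UNIV. partial_deriv j (partial_deriv j f) x)"
  by (simp add: laplacian_def fun_eq_iff)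

text \<open>
  Moving all derivatives to one side turns \<open>\<langle>D\<^sub>j\<^sup>2 f, D\<^sub>k\<^sup>2 f\<rangle>\<close> into \<open>\<langle>B\<^sub>k\<^sup>2 D\<^sub>j\<^sup>2 f, f\<rangle>\<close>, and the commutator
  formula into \<open>\<langle>B\<^sub>k\<^sup>2 f, B\<^sub>j\<^sup>2 f\<rangle>\<close> plus diagonal terms. Summing over \<open>j\<close> and \<open>k\<close> compares \<open>\<parallel>\<Delta> f\<parallel>\<^sup>2\<close> with
  \<open>\<parallel>S\<parallel>\<^sup>2\<close>, where \<open>S = \<Sum>\<^sub>j B\<^sub>j\<^sup>2 f\<close> is the adjoint of the Laplacian applied to \<open>f\<close>. The contributions of \<open>l\<close> to
  \<open>\<parallel>\<Delta> f + l f\<parallel>\<^sup>2\<close> and to \<open>\<parallel>S + cnj l f\<parallel>\<^sup>2\<close> are equal because \<open>\<langle>S, f\<rangle>\<close> is the conjugate of \<open>\<langle>\<Delta> f, f\<rangle>\<close>.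
\<close>

lemma laplacian_lower_bound:
  fixes f :: "real ^ 'n::finite \<Rightarrow> complex"
  assumes f: "test_function f"
  shows "8 * real CARD('n) * Re (gauss_inner f f) \<le>
    Re (gauss_inner (\<lambda>x. laplacian f x + l * f x) (\<lambda>x. laplacian f x + l * f x))"
proof -
  note T = test_function_partial_deriv test_function_adj_deriv f
  let ?D2 = "\<lambda>j. partial_deriv j (partial_deriv j f)"
  let ?B2 = "\<lambda>j. adj_deriv j (adj_deriv j f)"
  define S where "S x = (\<Sum>j\<in>UNIV. ?B2 j x)" for x
  have testS: "test_function S"
    unfolding S_def[abs_def] by (intro test_function_sum T)
  have testL: "test_function (laplacian f)" by (rule test_function_laplacian[OF f])
  define d where "d j = gauss_inner (adj_deriv j f) (adj_deriv j f)" for j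
  have D2: "gauss_inner (?D2 j) (?D2 k) = gauss_inner (?B2 k) (?B2 j) + (if k = j then 8 * (d j + gauss_inner f f) else 0)" for j k
  proof -
    have "gauss_inner (?D2 j) (?D2 k) = gauss_inner (adj_deriv k (?D2 j)) (partial_deriv k f)"
      by (subst gauss_inner_adj_deriv_left) (auto intro: T)
    also have "\<dots> = gauss_inner (adj_deriv k (adj_deriv k (?D2 j))) f"
      by (subst gauss_inner_adj_deriv_left) (auto intro: T)
    also have "\<dots> = gauss_inner (partial_deriv j (partial_deriv j (?B2 k))) f +
        (if k = j then 8 else 0) * (gauss_inner (partial_deriv j (adj_deriv j f)) f + gauss_inner f f)"
      unfolding adj_deriv_sq_partial_deriv_sq[OF f]
      by (simp only: gauss_inner_add_left gauss_inner_cmult_left test_function_add test_function_cmult T)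
    also have "gauss_inner (partial_deriv j (adj_deriv j f)) f = d j"
      unfolding d_def by (rule gauss_inner_partial_deriv_left) (intro T)+
    also have "gauss_inner (partial_deriv j (partial_deriv j (?B2 k))) f = gauss_inner (?B2 k) (?B2 j)"
      by (simp only: gauss_inner_partial_deriv_left T)
    finally show ?thesis by simp
  qed
  have "gauss_inner (laplacian f) (laplacian f) = (\<Sum>j\<in>UNIV. \<Sum>k\<in>UNIV. gauss_inner (?D2 j) (?D2 k))"
    unfolding laplacian_eq by (simp only: gauss_inner_sum_left gauss_inner_sum_right test_function_sum T)
  also have "\<dots> = (\<Sum>j\<in>UNIV. \<Sum>k\<in>UNIV. gauss_inner (?B2 k) (?B2 j)) + (\<Sum>j\<in>UNIV. 8 * (d j + gauss_inner f f))"
    unfolding D2 by (simp add: sum.distrib)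
  also have "(\<Sum>j\<in>UNIV. \<Sum>k\<in>UNIV. gauss_inner (?B2 k) (?B2 j)) = gauss_inner S S"
    unfolding S_def[abs_def]
    by (subst sum.swap) (simp only: gauss_inner_sum_left gauss_inner_sum_right test_function_sum T)
  also have "(\<Sum>j\<in>UNIV. 8 * (d j + gauss_inner f f)) = 8 * (\<Sum>j\<in>UNIV. d j) + 8 * of_nat CARD('n) * gauss_inner f f"
    unfolding sum_distrib_left[symmetric] sum.distrib by (simp add: algebra_simps)
  finally have LL: "Re (gauss_inner (laplacian f) (laplacian f)) =
      Re (gauss_inner S S) + 8 * (\<Sum>j\<in>UNIV. Re (d j)) + 8 * real CARD('n) * Re (gauss_inner f f)"
    by simp
  have "gauss_inner S f = (\<Sum>j\<in>UNIV. gauss_inner f (?D2 j))"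
    unfolding S_def[abs_def] by (simp only: gauss_inner_sum_left gauss_inner_adj_deriv_left T)
  also have "\<dots> = cnj (gauss_inner (laplacian f) f)"
    unfolding laplacian_eq gauss_inner_cnj by (simp only: gauss_inner_sum_right T)
  finally have Sf: "gauss_inner S f = cnj (gauss_inner (laplacian f) f)" .
  have "Re (gauss_inner (\<lambda>x. laplacian f x + l * f x) (\<lambda>x. laplacian f x + l * f x)) =
      Re (gauss_inner (\<lambda>x. S x + cnj l * f x) (\<lambda>x. S x + cnj l * f x)) +
      8 * (\<Sum>j\<in>UNIV. Re (d j)) + 8 * real CARD('n) * Re (gauss_inner f f)"
    unfolding gauss_inner_add_cmult_self[OF testL f] gauss_inner_add_cmult_self[OF testS f] LL Sf by simp
  moreover have "0 \<le> Re (gauss_inner h h)" for h :: "real^'n \<Rightarrow> complex"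
    unfolding gauss_inner_self by (rule sq_norm_nonneg)
  then have "0 \<le> (\<Sum>j\<in>UNIV. Re (d j))" "0 \<le> Re (gauss_inner (\<lambda>x. S x + cnj l * f x) (\<lambda>x. S x + cnj l * f x))"
    by (auto simp: d_def intro!: sum_nonneg)
  ultimately show ?thesis by linarith
qed

section \<open>Weak solutions\<close>

lemma laplacian_add_cmult:
  assumes "test_function f" "test_function g"
  shows "laplacian (\<lambda>x. f x + c * g x) = (\<lambda>x. laplacian f x + c * laplacian g x)"
  by (simp add: laplacian_eq fun_eq_iff partial_deriv_add_cmult assms test_function_partial_deriv
      sum.distrib sum_distrib_left)

lemma laplacian_funpow_add_cmult:
  assumes "test_function f" "test_function g"
  shows "test_function ((laplacian ^^ k) f) \<and> (laplacian ^^ k) (\<lambda>x. f x + c * g x) =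
     (\<lambda>x. (laplacian ^^ k) f x + c * (laplacian ^^ k) g x)"
proof -
  have T: "test_function ((laplacian ^^ k) h)" if "test_function h" for h :: "real^'a \<Rightarrow> complex" and k
    using that by (induction k) (auto intro: test_function_laplacian)
  have "(laplacian ^^ k) (\<lambda>x. f x + c * g x) = (\<lambda>x. (laplacian ^^ k) f x + c * (laplacian ^^ k) g x)"
    by (induction k) (auto simp: laplacian_add_cmult[OF T T] assms)
  with T[OF assms(1)] show ?thesis by blast
qed

abbreviation sq_weighted :: "(real ^ 'n::finite \<Rightarrow> complex) \<Rightarrow> real" where
  "sq_weighted f \<equiv> \<integral>x. (cmod (f x))\<^sup>2 * exp (- ((norm x)\<^sup>2)) \<partial>lebesgue"

lemma cmod_half_weight_sq:
  "(cmod (of_real (exp (- ((norm x)\<^sup>2) / 2)) * z))\<^sup>2 = (cmod z)\<^sup>2 * exp (- ((norm x)\<^sup>2))"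
proof -
  have "(exp (- ((norm x)\<^sup>2) / 2))\<^sup>2 = exp (- ((norm x)\<^sup>2))"
    by (simp add: power2_eq_square flip: exp_add)
  then show ?thesis by (simp add: norm_mult power_mult_distrib)
qed

text \<open>
  Local square integrability is automatic here, because the weight is bounded below on every compact
  set.
\<close>

lemma L2_weighted_gauss_iff:
  fixes f :: "real ^ 'n::finite \<Rightarrow> complex"
  shows "f \<in> L2_weighted (\<lambda>x. (norm x)\<^sup>2) \<longleftrightarrow>
    square_integrable lebesgue (\<lambda>x. of_real (exp (- ((norm x)\<^sup>2) / 2)) * f x)" (is "_ \<longleftrightarrow> square_integrable _ ?F")
proof
  have cont: "(\<lambda>x::real^'n. complex_of_real (exp (c * (norm x)\<^sup>2))) \<in> borel_measurable lebesgue" for c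
    by (intro measurable_completion) (simp add: borel_measurable_continuous_onI continuous_intros)
  {
    assume "f \<in> L2_weighted (\<lambda>x. (norm x)\<^sup>2)"
    then show "square_integrable lebesgue ?F"
      using cont[of "-1/2"] unfolding square_integrable_def cmod_half_weight_sq
      by (auto simp: L2_weighted_def L2_loc_def)
  }
  assume F: "square_integrable lebesgue ?F"
  then have int: "integrable lebesgue (\<lambda>x. (cmod (f x))\<^sup>2 * exp (- ((norm x)\<^sup>2)))"
    unfolding square_integrable_def cmod_half_weight_sq by blast
  have "(\<lambda>x. complex_of_real (exp ((1/2) * (norm x)\<^sup>2)) * ?F x) \<in> borel_measurable lebesgue"
    using F unfolding square_integrable_def by (intro borel_measurable_times[OF cont]) blast
  moreover have "complex_of_real (exp ((1/2) * (norm x)\<^sup>2)) * ?F x = f x" for x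
    by (simp add: mult.assoc[symmetric] flip: of_real_mult exp_add)
  ultimately have meas: "f \<in> borel_measurable lebesgue" by (simp only:)
  have "set_integrable lebesgue K (\<lambda>x. (cmod (f x))\<^sup>2)" if "compact K" for K
  proof -
    obtain R where R: "\<And>x. x \<in> K \<Longrightarrow> norm x \<le> R"
      using compact_imp_bounded[OF \<open>compact K\<close>] by (auto simp: bounded_iff)
    show ?thesis unfolding set_integrable_def
    proof (rule Bochner_Integration.integrable_bound)
      show "integrable lebesgue (\<lambda>x. exp (R\<^sup>2) * ((cmod (f x))\<^sup>2 * exp (- ((norm x)\<^sup>2))))"
        using int by simp
      show "(\<lambda>x. indicator K x *\<^sub>R (cmod (f x))\<^sup>2) \<in> borel_measurable lebesgue"
        using meas lmeasurable_compact[OF that] by (intro borel_measurable_scaleR borel_measurable_indicator) (auto simp: fmeasurable_def)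
      have "norm (indicator K x *\<^sub>R (cmod (f x))\<^sup>2) \<le> norm (exp (R\<^sup>2) * ((cmod (f x))\<^sup>2 * exp (- ((norm x)\<^sup>2))))" for x
      proof (cases "x \<in> K")
        case True
        have "(norm x)\<^sup>2 \<le> R\<^sup>2" using R[OF True] by (intro power_mono) auto
        then have "1 \<le> exp (R\<^sup>2) * exp (- ((norm x)\<^sup>2))" by (simp flip: exp_add)
        then have "1 * (cmod (f x))\<^sup>2 \<le> (exp (R\<^sup>2) * exp (- ((norm x)\<^sup>2))) * (cmod (f x))\<^sup>2"
          by (rule mult_right_mono) simp
        then show ?thesis using True by (simp add: mult_ac)
      qed simp
      then show "AE x in lebesgue. norm (indicator K x *\<^sub>R (cmod (f x))\<^sup>2)
          \<le> norm (exp (R\<^sup>2) * ((cmod (f x))\<^sup>2 * exp (- ((norm x)\<^sup>2))))" by simp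
    qed
  qed
  with meas int show "f \<in> L2_weighted (\<lambda>x. (norm x)\<^sup>2)"
    by (auto simp: L2_weighted_def L2_loc_def)
qed

text \<open>
  After multiplication by \<open>\<surd>W\<close> the functional \<open>(\<Delta> + l) \<phi> \<mapsto> \<integral> f \<phi>\<close> is bounded on a subspace of the unweighted
  \<open>L\<^sup>2\<close>, by the Cauchy-Schwarz inequality and \<open>laplacian_lower_bound\<close>. If \<open>U\<close> represents it, then
  \<open>u = \<surd>W U\<close> is the solution, and \<open>\<bar>u\<bar>\<^sup>2 / W = \<bar>U\<bar>\<^sup>2\<close>.
\<close>

lemma solve_laplacian_shift:
  fixes f :: "real ^ 'n::finite \<Rightarrow> complex"
  assumes f: "f \<in> L2_weighted (\<lambda>x. (norm x)\<^sup>2)"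
  obtains u where "u \<in> L2_weighted (\<lambda>x. (norm x)\<^sup>2)"
    and "sq_weighted u \<le> sq_weighted f / (8 * real CARD('n))"
    and "\<And>\<phi>. test_function \<phi> \<Longrightarrow>
      (\<integral>x. u x * (laplacian \<phi> x + l * \<phi> x) \<partial>lebesgue) = (\<integral>x. f x * \<phi> x \<partial>lebesgue)"
proof -
  let ?e = "\<lambda>x::real^'n. complex_of_real (exp (- ((norm x)\<^sup>2) / 2))"
  let ?F = "\<lambda>x. ?e x * f x"
  let ?L = "\<lambda>\<phi> x. laplacian \<phi> x + l * \<phi> x"
  have F: "square_integrable lebesgue ?F" using f by (simp only: L2_weighted_gauss_iff)
  have sqF: "sq_norm lebesgue ?F = sq_weighted f"
    by (simp only: sq_norm_def cmod_half_weight_sq)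
  define C where "C = sq_weighted f / (8 * real CARD('n))"
  have n: "0 < 8 * real CARD('n)" by simp
  have "0 \<le> C" using sq_norm_nonneg[of lebesgue ?F] unfolding C_def sqF by simp
  have e: "half_weighted g x * ?e x = g x" for g x
  proof -
    have "exp ((norm x)\<^sup>2 / 2) * exp (- ((norm x)\<^sup>2) / 2) = 1" by (simp flip: exp_add)
    then have "complex_of_real (exp ((norm x)\<^sup>2 / 2)) * ?e x = 1" by (metis of_real_1 of_real_mult)
    then show ?thesis by (simp add: half_weighted_def mult_ac)
  qed
  have F_half: "?F x * half_weighted \<phi> x = f x * \<phi> x" for \<phi> x
    using e[of \<phi> x] by (simp add: mult_ac)
  have testL: "test_function (?L \<phi>)" if "test_function \<phi>" for \<phi>
    using that by (intro test_function_add test_function_cmult test_function_laplacian)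
  have int: "integrable lebesgue (\<lambda>x. f x * \<phi> x)" if "test_function \<phi>" for \<phi>
    using square_integrable_mult[OF F square_integrable_half_weighted[OF that]] by (simp only: F_half)
  define G where "G = {(half_weighted (?L \<phi>), \<integral>x. f x * \<phi> x \<partial>lebesgue) | \<phi>. test_function \<phi>}"
  obtain U where U: "square_integrable lebesgue U" "sq_norm lebesgue U \<le> C"
    and rep: "\<And>v c. (v, c) \<in> G \<Longrightarrow> c = (\<integral>x. U x * v x \<partial>lebesgue)"
  proof (rule riesz_representation_graph[of G C lebesgue])
    show "G \<noteq> {}" using test_function_0 by (auto simp: G_def)
    show "0 \<le> C" by fact
    fix v c assume "(v, c) \<in> G"
    then obtain \<phi> where \<phi>: "test_function \<phi>" and v: "v = half_weighted (?L \<phi>)"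
      and c: "c = (\<integral>x. f x * \<phi> x \<partial>lebesgue)" by (auto simp: G_def)
    show "square_integrable lebesgue v"
      unfolding v by (intro square_integrable_half_weighted testL \<phi>)
    have "(cmod c)\<^sup>2 \<le> sq_norm lebesgue ?F * sq_norm lebesgue (half_weighted \<phi>)"
      using cauchy_schwarz_integral[OF F square_integrable_half_weighted[OF \<phi>]] by (simp only: F_half c)
    also have "\<dots> \<le> sq_norm lebesgue ?F * (sq_norm lebesgue v / (8 * real CARD('n)))"
      using laplacian_lower_bound[OF \<phi>, of l] unfolding gauss_inner_self v[symmetric]
      by (intro mult_left_mono sq_norm_nonneg pos_le_divide_eq[OF n, THEN iffD2]) (simp add: mult_ac)
    also have "\<dots> = C * sq_norm lebesgue v" unfolding sqF C_def by simp
    finally show "(cmod c)\<^sup>2 \<le> C * sq_norm lebesgue v" .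
    fix z
    have "half_weighted (?L (\<lambda>x. z * \<phi> x)) = (\<lambda>x. z * v x)"
      using laplacian_add_cmult[OF test_function_0 \<phi>, of z] laplacian_add_cmult[OF test_function_0 test_function_0, of 1]
      by (simp add: v half_weighted_def fun_eq_iff algebra_simps)
    moreover have "(\<integral>x. f x * (z * \<phi> x) \<partial>lebesgue) = z * c"
      unfolding c integral_mult_right_zero[symmetric] by (simp add: mult_ac)
    ultimately show "(\<lambda>x. z * v x, z * c) \<in> G"
      unfolding G_def using test_function_cmult[OF \<phi>, of z] by force
    fix v' c' assume "(v', c') \<in> G"
    then obtain \<psi> where \<psi>: "test_function \<psi>" and v': "v' = half_weighted (?L \<psi>)"
      and c': "c' = (\<integral>x. f x * \<psi> x \<partial>lebesgue)" by (auto simp: G_def)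
    have "half_weighted (?L (\<lambda>x. \<phi> x + \<psi> x)) = (\<lambda>x. v x + v' x)"
      using laplacian_add_cmult[OF \<phi> \<psi>, of 1]
      by (simp add: v v' half_weighted_def fun_eq_iff algebra_simps)
    moreover have "(\<integral>x. f x * (\<phi> x + \<psi> x) \<partial>lebesgue) = c + c'"
      using int[OF \<phi>] int[OF \<psi>] by (simp add: c c' distrib_left)
    ultimately show "(\<lambda>x. v x + v' x, c + c') \<in> G"
      unfolding G_def using test_function_add[OF \<phi> \<psi>] by force
  qed blast
  have e': "?e x * half_weighted U x = U x" for x using e[of U x] by (simp add: mult.commute)
  show ?thesis
  proof
    show "half_weighted U \<in> L2_weighted (\<lambda>x. (norm x)\<^sup>2)"
      unfolding L2_weighted_gauss_iff e' by (rule U)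
    show "sq_weighted (half_weighted U) \<le> sq_weighted f / (8 * real CARD('n))"
      using U(2) unfolding C_def sq_norm_def cmod_half_weight_sq[symmetric] e' .
    fix \<phi> :: "real^'n \<Rightarrow> complex" assume "test_function \<phi>"
    then have "(\<integral>x. f x * \<phi> x \<partial>lebesgue) = (\<integral>x. U x * half_weighted (?L \<phi>) x \<partial>lebesgue)"
      by (intro rep) (auto simp: G_def)
    moreover have "half_weighted U x * ?L \<phi> x = U x * half_weighted (?L \<phi>) x" for x
      by (simp add: half_weighted_def)
    ultimately show "(\<integral>x. half_weighted U x * ?L \<phi> x \<partial>lebesgue) = (\<integral>x. f x * \<phi> x \<partial>lebesgue)"
      by (simp only:)
  qed
qed

lemma poly_laplacian_monic:
  assumes "coeff p m = 1"
  shows "poly_laplacian m (coeff p) f x = (\<Sum>k\<le>m. coeff p k * (laplacian ^^ k) f x)"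
  using assms by (simp add: poly_laplacian_def flip: lessThan_Suc_atMost)

lemma poly_laplacian_linear_factor:
  assumes q: "lead_coeff q = 1" and \<phi>: "test_function \<phi>"
  shows "poly_laplacian (Suc (degree q)) (coeff ([:-z, 1:] * q)) \<phi> x =
    poly_laplacian (degree q) (coeff q) (\<lambda>x. laplacian \<phi> x + (-z) * \<phi> x) x"
proof -
  let ?m = "degree q" and ?p = "[:-z, 1:] * q"
  have p0: "coeff ?p 0 = - z * coeff q 0" by simp
  have pS: "coeff ?p (Suc k) = coeff q k - z * coeff q (Suc k)" for k by simp
  have "coeff ?p (Suc ?m) = 1" using q unfolding pS by (simp add: coeff_eq_0)
  then have "poly_laplacian (Suc ?m) (coeff ?p) \<phi> x =
      (\<Sum>k\<le>Suc ?m. coeff ?p k * (laplacian ^^ k) \<phi> x)"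
    by (rule poly_laplacian_monic)
  also have "\<dots> = (\<Sum>k\<le>?m. coeff q k * (laplacian ^^ Suc k) \<phi> x) -
      z * (\<Sum>k\<le>Suc ?m. coeff q k * (laplacian ^^ k) \<phi> x)"
    unfolding sum.atMost_Suc_shift pS p0
    by (simp add: algebra_simps sum_subtractf sum_distrib_left sum.distrib)
  also have "(\<Sum>k\<le>Suc ?m. coeff q k * (laplacian ^^ k) \<phi> x) = (\<Sum>k\<le>?m. coeff q k * (laplacian ^^ k) \<phi> x)"
    by (simp add: coeff_eq_0)
  also have "(\<Sum>k\<le>?m. coeff q k * (laplacian ^^ Suc k) \<phi> x) -
      z * (\<Sum>k\<le>?m. coeff q k * (laplacian ^^ k) \<phi> x) =
      (\<Sum>k\<le>?m. coeff q k * (laplacian ^^ k) (\<lambda>x. laplacian \<phi> x + (-z) * \<phi> x) x)"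
    using laplacian_funpow_add_cmult[OF test_function_laplacian[OF \<phi>] \<phi>, of _ "-z"]
    by (simp add: sum_distrib_left funpow_swap1 algebra_simps flip: sum_subtractf)
  also have "\<dots> = poly_laplacian ?m (coeff q) (\<lambda>x. laplacian \<phi> x + (-z) * \<phi> x) x"
    by (rule poly_laplacian_monic[OF q, symmetric])
  finally show ?thesis .
qed

text \<open>
  If \<open>P = (X - z) Q\<close>, solve \<open>(\<Delta> - z) u\<^sub>1 = f\<close> and then \<open>Q(\<Delta>) u = u\<^sub>1\<close>. Testing the second equation
  with \<open>(\<Delta> - z) \<phi>\<close>, again a test function, gives \<open>P(\<Delta>) u = f\<close>. The induction starts at degree \<open>0\<close>,
  where \<open>u = f\<close>.
\<close>

lemma weak_solution_monic:
  fixes f :: "real ^ 'n::finite \<Rightarrow> complex"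
  assumes "f \<in> L2_weighted (\<lambda>x. (norm x)\<^sup>2)" "lead_coeff p = 1"
  shows "\<exists>u \<in> L2_weighted (\<lambda>x. (norm x)\<^sup>2). weak_solution (degree p) (coeff p) f u \<and>
     sq_weighted u \<le> 1 / (8 * real CARD('n)) ^ degree p * sq_weighted f"
  using assms
proof (induction "degree p" arbitrary: p f)
  case 0
  then show ?case
    by (intro bexI[of _ f]) (auto simp: weak_solution_def poly_laplacian_def)
next
  case (Suc m)
  obtain z where "poly p z = 0"
    using fundamental_theorem_of_algebra[of p] Suc.hyps(2) by (auto simp: constant_degree)
  then obtain q where p: "p = [:-z, 1:] * q"
    by (metis poly_eq_0_iff_dvd dvdE)
  have q: "lead_coeff q = 1" using Suc.prems(2) unfolding p lead_coeff_mult by simp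
  then have "q \<noteq> 0" by auto
  then have "degree p = Suc (degree q)" unfolding p by (subst degree_mult_eq) auto
  with Suc.hyps have m: "m = degree q" by simp
  obtain u1 where u1: "u1 \<in> L2_weighted (\<lambda>x. (norm x)\<^sup>2)"
    and u1_le: "sq_weighted u1 \<le> sq_weighted f / (8 * real CARD('n))"
    and u1_eq: "\<And>\<phi>. test_function \<phi> \<Longrightarrow>
      (\<integral>x. u1 x * (laplacian \<phi> x + (-z) * \<phi> x) \<partial>lebesgue) = (\<integral>x. f x * \<phi> x \<partial>lebesgue)"
    using solve_laplacian_shift[OF Suc.prems(1), of "-z"] by blast
  obtain u where u: "u \<in> L2_weighted (\<lambda>x. (norm x)\<^sup>2)"
    and u_eq: "weak_solution m (coeff q) u1 u"
    and u_le: "sq_weighted u \<le> 1 / (8 * real CARD('n)) ^ m * sq_weighted u1"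
    using Suc.hyps(1)[OF m u1 q] unfolding m by blast
  have "weak_solution (degree p) (coeff p) f u"
    unfolding weak_solution_def
  proof (intro allI impI)
    fix \<phi> :: "real^'n \<Rightarrow> complex" assume \<phi>: "test_function \<phi>"
    have "(\<integral>x. u x * poly_laplacian (degree p) (coeff p) \<phi> x \<partial>lebesgue) =
        (\<integral>x. u x * poly_laplacian m (coeff q) (\<lambda>x. laplacian \<phi> x + (-z) * \<phi> x) x \<partial>lebesgue)"
      unfolding \<open>degree p = Suc (degree q)\<close> m
      by (subst p) (simp only: poly_laplacian_linear_factor[OF q \<phi>])
    also have "\<dots> = (\<integral>x. u1 x * (laplacian \<phi> x + (-z) * \<phi> x) \<partial>lebesgue)"
      using u_eq \<phi> unfolding weak_solution_def
      by (blast intro: test_function_add test_function_cmult test_function_laplacian)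
    also have "\<dots> = (\<integral>x. f x * \<phi> x \<partial>lebesgue)" by (rule u1_eq[OF \<phi>])
    finally show "(\<integral>x. u x * poly_laplacian (degree p) (coeff p) \<phi> x \<partial>lebesgue) = (\<integral>x. f x * \<phi> x \<partial>lebesgue)" .
  qed
  moreover have "sq_weighted u \<le> 1 / (8 * real CARD('n)) ^ degree p * sq_weighted f"
  proof -
    have "sq_weighted u \<le> 1 / (8 * real CARD('n)) ^ m * (sq_weighted f / (8 * real CARD('n)))"
      using u_le mult_left_mono[OF u1_le, of "1 / (8 * real CARD('n)) ^ m"] by simp
    then show ?thesis using Suc.hyps(2) by (simp add: mult_ac flip: Suc.hyps(2))
  qed
  ultimately show ?case using u by blast
qed

theorem theorem1p1:
  fixes m :: nat and a :: "nat \<Rightarrow> complex" and f :: "real ^ 'n::finite \<Rightarrow> complex"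
  assumes "m \<ge> 1"
    and "f \<in> L2_weighted (\<lambda>x. (norm x)\<^sup>2)"
  shows "\<exists>u \<in> L2_weighted (\<lambda>x. (norm x)\<^sup>2).
           weak_solution m a f u \<and>
           (\<integral>x. (cmod (u x))\<^sup>2 * exp (- ((norm x)\<^sup>2)) \<partial>lebesgue)
             \<le> 1 / (8 * real CARD('n)) ^ m *
                (\<integral>x. (cmod (f x))\<^sup>2 * exp (- ((norm x)\<^sup>2)) \<partial>lebesgue)"
proof -
  define p where "p = monom 1 m + (\<Sum>k<m. monom (a k) k)"
  have p: "coeff p k = (if k = m then 1 else 0) + (if k < m then a k else 0)" for k
    by (simp add: p_def coeff_sum)
  have "degree p \<le> m" by (rule degree_le) (simp add: p)
  moreover have "coeff p m = 1" by (simp add: p)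
  ultimately have "degree p = m" "lead_coeff p = 1"
    using le_degree[of p m] by fastforce+
  moreover have "poly_laplacian m (coeff p) = (poly_laplacian m a :: (real ^ 'n \<Rightarrow> complex) \<Rightarrow> _)"
    by (simp add: poly_laplacian_def fun_eq_iff p)
  ultimately show ?thesis
    using weak_solution_monic[OF assms(2), of p] by (simp add: weak_solution_def)
qed

end
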